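(* There exists an absolute constant $c>0$ such that for every $n\ge 1$, every log-concave probability measure $\mu$ on $\mathbb{R}^n$ and every $0<p\le c/n$, $$J_{\mu}(p):=\int_{\mathbb{R}^n}\frac{1}{\varphi_{\mu}(x)^p}\,d\mu(x)<\infty .$$
   Context: A Borel probability measure $\mu$ on $\mathbb{R}^n$ is called log-concave if $\mu(H)<1$ for every hyperplane $H$ of $\mathbb{R}^n$ and $\mu(\lambda A+(1-\lambda)B)\ge \mu(A)^{\lambda}\mu(B)^{1-\lambda}$ for all compact sets $A,B\subset\mathbb{R}^n$ and all $\lambda\in(0,1)$. Tukey's half-space depth of $\mu$ is the function $\varphi_\mu(x)=\inf\{\mu(H): H \text{ is a closed half-space of }\mathbb{R}^n\text{ containing }x\}$. "Absolute constant" means a constant independent of $n$ and $\mu$. *)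

theory Defs
  imports "HOL-Probability.Probability"
begin

text \<open>
  The dimension is quantified inside the statement, so n-space is the library's
  \<^const>\<open>Euclidean_space\<close> \<open>n\<close>: sequences vanishing from index \<open>n\<close> on,
  with the usual topology. Its vector operations are pointwise.
\<close>

definition Euclidean_borel :: "nat \<Rightarrow> (nat \<Rightarrow> real) measure" where
  "Euclidean_borel n = sigma (topspace (Euclidean_space n)) {U. openin (Euclidean_space n) U}"

definition dot :: "nat \<Rightarrow> (nat \<Rightarrow> real) \<Rightarrow> (nat \<Rightarrow> real) \<Rightarrow> real" where
  "dot n a x = (\<Sum>i<n. a i * x i)"

definition hyperplanes :: "nat \<Rightarrow> (nat \<Rightarrow> real) set set" where
  "hyperplanes n = {{x \<in> topspace (Euclidean_space n). dot n a x = b} | a b.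
     a \<in> topspace (Euclidean_space n) \<and> a \<noteq> (\<lambda>_. 0)}"

definition closed_halfspaces :: "nat \<Rightarrow> (nat \<Rightarrow> real) set set" where
  "closed_halfspaces n = {{x \<in> topspace (Euclidean_space n). dot n a x \<ge> b} | a b.
     a \<in> topspace (Euclidean_space n) \<and> a \<noteq> (\<lambda>_. 0)}"

definition minkowski_comb :: "real \<Rightarrow> (nat \<Rightarrow> real) set \<Rightarrow> (nat \<Rightarrow> real) set \<Rightarrow> (nat \<Rightarrow> real) set" where
  "minkowski_comb l A B = {\<lambda>i. l * x i + (1 - l) * y i | x y. x \<in> A \<and> y \<in> B}"

definition log_concave_prob :: "nat \<Rightarrow> (nat \<Rightarrow> real) measure \<Rightarrow> bool" where
  "log_concave_prob n \<mu> \<longleftrightarrow>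
     prob_space \<mu> \<and> sets \<mu> = sets (Euclidean_borel n) \<and>
     (\<forall>H\<in>hyperplanes n. measure \<mu> H < 1) \<and>
     (\<forall>A B l. compactin (Euclidean_space n) A \<longrightarrow> compactin (Euclidean_space n) B \<longrightarrow>
        0 < l \<longrightarrow> l < 1 \<longrightarrow>
        measure \<mu> (minkowski_comb l A B) \<ge> measure \<mu> A powr l * measure \<mu> B powr (1 - l))"

definition halfspace_depth :: "nat \<Rightarrow> (nat \<Rightarrow> real) measure \<Rightarrow> (nat \<Rightarrow> real) \<Rightarrow> real" where
  "halfspace_depth n \<mu> x = (INF H\<in>{H \<in> closed_halfspaces n. x \<in> H}. measure \<mu> H)"

text \<open>The division is in \<^typ>\<open>ennreal\<close>, so the integrand is \<open>\<infinity>\<close> where the depth vanishes.\<close>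

definition depth_integral :: "nat \<Rightarrow> (nat \<Rightarrow> real) measure \<Rightarrow> real \<Rightarrow> ennreal" where
  "depth_integral n \<mu> p = (\<integral>\<^sup>+ x. 1 / ennreal (halfspace_depth n \<mu> x powr p) \<partial>\<mu>)"

end

theory Submission
  imports Defs
begin

text \<open>
  Let \<open>shallow t\<close> be the union of the open half-spaces of measure below \<open>t\<close>. It contains every point
  of depth below \<open>t\<close> and has a convex complement. It suffices that its measure is
  \<open>O(t powr (1 / (4 * n)))\<close>, with a constant depending on \<open>\<mu>\<close>. Put \<open>\<epsilon> = t powr (1 / (2 * n))\<close> and split
  \<open>shallow t\<close> into three parts, working directly with the log-concavity inequality and never
  with a density.

  (i) The part far from the centre is controlled by Borell's tail estimate.

  (ii) The part that remains in \<open>shallow t\<close> after contraction by \<open>1 - \<epsilon>\<close> towards a central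
  point \<open>z\<close>: by pigeonhole some cube of side about \<open>\<epsilon>\<close> around one of its points \<open>y\<close> carries a
  fraction of order \<open>\<epsilon> ^ n\<close> of its measure, up to the \<open>n\<close>-th power of the radius of the region. The
  contracted point lies in a half-space of measure below \<open>t\<close>, and this half-space contains the
  combination of the cube with weight \<open>1 - \<epsilon>\<close> and a set of fixed measure with weight \<open>\<epsilon>\<close>.

  (iii) The thin shell that leaves \<open>shallow t\<close> under the contraction: moving it by the weight \<open>4 * j * \<epsilon>\<close>
  towards a small cube around \<open>z\<close>, for \<open>j\<close> up to about \<open>1 / (8 * n * \<epsilon>)\<close>, gives subsets of disjoint shells.
  Each has at least \<open>const * sqrt \<epsilon>\<close> times the measure of the original shell, which is therefore
  \<open>O(sqrt \<epsilon>)\<close>. Here \<open>z\<close> is chosen, depending on \<open>\<epsilon>\<close>, so that the small cube has measure of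
  order \<open>\<epsilon> ^ n\<close>.
\<close>

section \<open>Convex combinations, sup-norm balls and linear functionals\<close>

definition comb :: "real \<Rightarrow> (nat \<Rightarrow> real) \<Rightarrow> (nat \<Rightarrow> real) \<Rightarrow> nat \<Rightarrow> real" where
  "comb l x y = (\<lambda>i. l * x i + (1 - l) * y i)"

definition cube :: "nat \<Rightarrow> (nat \<Rightarrow> real) \<Rightarrow> real \<Rightarrow> (nat \<Rightarrow> real) set" where
  "cube n p r = {x \<in> topspace (Euclidean_space n). \<forall>i<n. \<bar>x i - p i\<bar> \<le> r}"

text \<open>The norm dual to the sup norm whose balls are the cubes: on a cube of radius
  \<open>r\<close> the functional \<open>dot n a\<close> differs from its value at the centre by at
  most \<open>r * norm1 n a\<close>.\<close>

definition norm1 :: "nat \<Rightarrow> (nat \<Rightarrow> real) \<Rightarrow> real" where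
  "norm1 n a = (\<Sum>i<n. \<bar>a i\<bar>)"

lemma minkowski_comb_eq: "minkowski_comb l A B = {comb l x y | x y. x \<in> A \<and> y \<in> B}"
  by (simp add: minkowski_comb_def comb_def)

lemma comb_in_topspace:
  assumes "x \<in> topspace (Euclidean_space n)" "y \<in> topspace (Euclidean_space n)"
  shows "comb l x y \<in> topspace (Euclidean_space n)"
  using assms by (simp add: topspace_Euclidean_space comb_def)

lemma dot_comb: "dot n a (comb l x y) = l * dot n a x + (1 - l) * dot n a y"
  by (simp add: dot_def comb_def sum_distrib_left sum.distrib[symmetric] algebra_simps
      flip: sum_subtractf)

lemma norm1_nonneg: "norm1 n a \<ge> 0"
  by (simp add: norm1_def sum_nonneg)

lemma abs_dot_diff_le:
  assumes "\<And>i. i < n \<Longrightarrow> \<bar>x i - y i\<bar> \<le> r"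
  shows "\<bar>dot n a x - dot n a y\<bar> \<le> r * norm1 n a"
proof -
  have "\<bar>dot n a x - dot n a y\<bar> = \<bar>\<Sum>i<n. a i * (x i - y i)\<bar>"
    by (simp add: dot_def algebra_simps sum_subtractf)
  also have "\<dots> \<le> (\<Sum>i<n. \<bar>a i * (x i - y i)\<bar>)" by (rule sum_abs)
  also have "\<dots> \<le> (\<Sum>i<n. r * \<bar>a i\<bar>)"
    using assms by (intro sum_mono) (auto simp: abs_mult mult.commute[of r] intro!: mult_left_mono)
  finally show ?thesis by (simp add: norm1_def sum_distrib_left)
qed

section \<open>Topology and Borel sets of n-space\<close>

lemma Euclidean_space_top_of_set: "Euclidean_space n = top_of_set {x. \<forall>i\<ge>n. x i = 0}"
  by (simp add: Euclidean_space_def euclidean_product_topology)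

lemma compactin_Euclidean_space:
  "compactin (Euclidean_space n) K \<longleftrightarrow> compact K \<and> K \<subseteq> topspace (Euclidean_space n)"
  by (simp add: Euclidean_space_top_of_set compactin_subtopology)

lemma closed_topspace_Euclidean_space: "closed (topspace (Euclidean_space n))"
  using closedin_Euclidean_space_iff closedin_topspace by blast

text \<open>Open sets of n-space are traces of open sets of the product, and taking traces commutes
  with generating a sigma-algebra. As the carrier is closed, the traces of Borel sets are exactly
  the Borel subsets of the carrier.\<close>

lemma sets_Euclidean_borel:
  "A \<in> sets (Euclidean_borel n) \<longleftrightarrow> A \<in> sets borel \<and> A \<subseteq> topspace (Euclidean_space n)"
proof -
  let ?X = "topspace (Euclidean_space n)"
  have X: "?X \<in> sets borel" by (intro borel_closed closed_topspace_Euclidean_space)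
  have op: "{U. openin (Euclidean_space n) U} = (\<inter>) ?X ` {S. open S}"
    by (auto simp: Euclidean_space_top_of_set openin_open)
  have "sets (Euclidean_borel n) = sigma_sets ?X {U. openin (Euclidean_space n) U}"
    unfolding Euclidean_borel_def using openin_subset by (intro sets_measure_of) auto
  also have "\<dots> = (\<inter>) ?X ` sigma_sets UNIV {S. open S}"
    unfolding op using X by (intro sigma_sets_Int[symmetric]) (auto simp: sets_borel)
  finally show ?thesis using X by (auto simp flip: sets_borel)
qed

lemma space_Euclidean_borel: "space (Euclidean_borel n) = topspace (Euclidean_space n)"
  unfolding Euclidean_borel_def using openin_subset by (intro space_measure_of) auto

lemma continuous_on_coordinate:
  "continuous_on S (\<lambda>x::nat \<Rightarrow> real. x i)"
  by (rule continuous_on_subset[OF continuous_on_product_coordinates]) simp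

lemma continuous_on_dot: "continuous_on S (dot n a)"
proof -
  have "continuous_on S (\<lambda>x. \<Sum>i<n. a i * x i)"
    by (intro continuous_on_sum continuous_on_mult_left continuous_on_coordinate)
  thus ?thesis by (simp add: dot_def[abs_def])
qed

lemma closed_cube: "closed (cube n p r)"
proof -
  have "cube n p r = topspace (Euclidean_space n) \<inter> (\<Inter>i\<in>{..<n}. {x. \<bar>x i - p i\<bar> \<le> r})"
    by (auto simp: cube_def)
  moreover have "closed (\<Inter>i\<in>{..<n}. {x. \<bar>x i - p i\<bar> \<le> r})"
    by (intro closed_INT ballI closed_Collect_le continuous_on_coordinate continuous_on_rabs
        continuous_on_diff continuous_on_const)
  ultimately show ?thesis using closed_topspace_Euclidean_space by auto
qed

lemma open_Collect_continuous_mem: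
  assumes "continuous_on UNIV f" "open S"
  shows "open {x. f x \<in> S}"
  using open_vimage[OF assms(2,1)] by (simp add: vimage_def)

section \<open>The log-concavity inequality for Borel sets\<close>

locale log_concave =
  fixes n :: nat and \<mu> :: "(nat \<Rightarrow> real) measure"
  assumes log_concave: "log_concave_prob n \<mu>"
begin

abbreviation X :: "(nat \<Rightarrow> real) set" where "X \<equiv> topspace (Euclidean_space n)"

sublocale prob_space \<mu>
  using log_concave by (simp add: log_concave_prob_def)

lemma sets_mu: "A \<in> sets \<mu> \<longleftrightarrow> A \<in> sets borel \<and> A \<subseteq> X"
  using log_concave sets_Euclidean_borel by (simp add: log_concave_prob_def)

lemma space_mu: "space \<mu> = X"
  using log_concave space_Euclidean_borel sets_eq_imp_space_eq
  by (metis log_concave_prob_def)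

lemma X_sets: "X \<in> sets \<mu>"
  using space_mu sets.top[of \<mu>] by simp

lemma prob_X: "prob X = 1"
  using prob_space space_mu by simp

lemma cube_sets [measurable]: "cube n p r \<in> sets \<mu>"
  by (auto simp: sets_mu closed_cube borel_closed) (simp add: cube_def)

lemma open_sets: "open U \<Longrightarrow> X \<inter> U \<in> sets \<mu>"
  using X_sets by (auto simp: sets_mu)

text \<open>Inner regularity holds for finite Borel measures on the whole Polish type
  \<open>nat \<Rightarrow> real\<close>, so \<open>\<mu>\<close> is pushed forward along the
  inclusion of \<open>X\<close>.\<close>

lemma inner_regular_prob:
  assumes "A \<in> sets \<mu>" "e > 0"
  obtains K where "compact K" "K \<subseteq> A" "K \<in> sets \<mu>" "prob K > prob A - e"
proof -
  define M where "M = distr \<mu> borel (\<lambda>x. x)"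
  have meas: "(\<lambda>x. x) \<in> measurable \<mu> borel"
  proof (rule measurableI)
    fix B :: "(nat \<Rightarrow> real) set" assume "B \<in> sets borel"
    thus "(\<lambda>x. x) -` B \<inter> space \<mu> \<in> sets \<mu>"
      using X_sets by (auto simp: space_mu sets_mu)
  qed auto
  interpret M: prob_space M unfolding M_def by (rule prob_space_distr[OF meas])
  have eq: "emeasure M B = emeasure \<mu> B" if "B \<in> sets \<mu>" for B
  proof -
    have "B \<in> sets borel" "B \<subseteq> X" using that by (auto simp: sets_mu)
    thus ?thesis unfolding M_def using emeasure_distr[OF meas, of B]
      by (simp add: space_mu Int_absorb2)
  qed
  show ?thesis
  proof (cases "prob A < e")
    case True
    thus ?thesis using that[of "{}"] by simp
  next
    case False
    have A: "A \<in> sets borel" "A \<subseteq> X" using assms by (auto simp: sets_mu)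
    have "emeasure M A = (SUP K \<in> {K. K \<subseteq> A \<and> compact K}. emeasure M K)"
      by (rule inner_regular) (auto simp: M_def A(1) M.emeasure_finite[unfolded M_def])
    moreover have "ennreal (prob A - e) < emeasure M A"
      using False assms by (simp add: eq emeasure_eq_measure ennreal_less_iff)
    ultimately obtain K where K: "K \<subseteq> A" "compact K" "ennreal (prob A - e) < emeasure M K"
      by (auto simp: less_SUP_iff)
    have "K \<in> sets \<mu>" using K A by (auto simp: sets_mu compact_imp_closed borel_closed)
    with K show ?thesis using that[of K] False
      by (simp add: eq emeasure_eq_measure ennreal_less_iff)
  qed
qed

text \<open>A measurable superset \<open>C\<close> replaces the Minkowski combination itself, so
  that the measurability of such combinations never has to be discussed.\<close>

lemma prob_comb_ge_compact:
  assumes "compact A" "compact B" "A \<subseteq> X" "B \<subseteq> X" "0 < l" "l < 1" "C \<in> sets \<mu>"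
    and "\<And>x y. x \<in> A \<Longrightarrow> y \<in> B \<Longrightarrow> comb l x y \<in> C"
  shows "prob C \<ge> prob A powr l * prob B powr (1 - l)"
proof -
  have "prob A powr l * prob B powr (1 - l) \<le> prob (minkowski_comb l A B)"
    using log_concave assms unfolding log_concave_prob_def
    by (auto simp: compactin_Euclidean_space)
  also have "\<dots> \<le> prob C"
    using assms by (intro finite_measure_mono) (auto simp: minkowski_comb_eq)
  finally show ?thesis by simp
qed

text \<open>Exhaust \<open>A\<close> and \<open>B\<close> by compact subsets and pass to the limit;
  \<open>powr\<close> is continuous in the base here because both exponents are positive. All later
  uses of log-concavity go through this form.\<close>

lemma prob_comb_ge:
  assumes "A \<in> sets \<mu>" "B \<in> sets \<mu>" "C \<in> sets \<mu>" "0 < l" "l < 1"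
    and "\<And>x y. x \<in> A \<Longrightarrow> y \<in> B \<Longrightarrow> comb l x y \<in> C"
  shows "prob C \<ge> prob A powr l * prob B powr (1 - l)"
proof -
  have "\<exists>K. compact K \<and> K \<subseteq> S \<and> prob K > prob S - 1 / Suc k" if "S \<in> sets \<mu>" for S k
    using inner_regular_prob[OF that, of "1 / Suc k"] by (metis of_nat_0_less_iff zero_less_Suc zero_less_divide_1_iff)
  then obtain K where K: "\<And>S k. S \<in> sets \<mu> \<Longrightarrow> compact (K S k) \<and> K S k \<subseteq> S \<and> prob (K S k) > prob S - 1 / Suc k"
    by metis
  have lim: "(\<lambda>k. prob (K S k)) \<longlonglongrightarrow> prob S" if S: "S \<in> sets \<mu>" for S
  proof (rule tendsto_sandwich)
    show "(\<lambda>k. prob S - 1 / real (Suc k)) \<longlonglongrightarrow> prob S"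
      using tendsto_diff[OF tendsto_const LIMSEQ_Suc[OF lim_1_over_n], of "prob S"] by simp
    show "\<forall>\<^sub>F k in sequentially. prob S - 1 / real (Suc k) \<le> prob (K S k)"
      using K[OF S] by (auto intro!: always_eventually less_imp_le)
    show "\<forall>\<^sub>F k in sequentially. prob (K S k) \<le> prob S"
      using K[OF S] S by (auto intro!: always_eventually finite_measure_mono)
  qed auto
  have "(\<lambda>k. prob (K A k) powr l * prob (K B k) powr (1 - l)) \<longlonglongrightarrow> prob A powr l * prob B powr (1 - l)"
    using assms lim by (intro tendsto_intros) auto
  moreover have "prob (K A k) powr l * prob (K B k) powr (1 - l) \<le> prob C" for k
    using K[OF assms(1), of k] K[OF assms(2), of k] assms(1,2)
    by (intro prob_comb_ge_compact assms) (auto simp: sets_mu)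
  ultimately show ?thesis by (meson LIMSEQ_le_const2)
qed

end

lemma comb_in_cube:
  assumes "x \<in> cube n p r" "y \<in> cube n q s" "0 \<le> l" "l \<le> 1"
  shows "comb l x y \<in> cube n (comb l p q) (l * r + (1 - l) * s)"
proof -
  have "\<bar>comb l x y i - comb l p q i\<bar> \<le> l * r + (1 - l) * s" if "i < n" for i
  proof -
    have "\<bar>comb l x y i - comb l p q i\<bar> = \<bar>l * (x i - p i) + (1 - l) * (y i - q i)\<bar>"
      by (simp add: comb_def algebra_simps)
    also have "\<dots> \<le> l * \<bar>x i - p i\<bar> + (1 - l) * \<bar>y i - q i\<bar>"
      using assms by (intro order_trans[OF abs_triangle_ineq]) (simp add: abs_mult)
    also have "\<dots> \<le> l * r + (1 - l) * s"
      using assms that by (intro add_mono mult_left_mono) (auto simp: cube_def)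
    finally show ?thesis .
  qed
  with assms show ?thesis by (auto simp: cube_def intro: comb_in_topspace)
qed

text \<open>Induction on the dimension. If the last coordinate vanishes on \<open>L\<close>, the
  last unit vector works. Otherwise some \<open>u\<close> in \<open>L\<close> has
  \<open>u n \<noteq> 0\<close>, \<open>L\<close> is spanned by \<open>u\<close> and the slice
  \<open>L0\<close>, the slice is proper one dimension lower, and the functional obtained there is
  extended so as to vanish at \<open>u\<close>.\<close>

lemma proper_subspace_orthogonal:
  assumes "L \<subseteq> topspace (Euclidean_space n)" "(\<lambda>_. 0) \<in> L"
    and "\<And>x y c. x \<in> L \<Longrightarrow> y \<in> L \<Longrightarrow> (\<lambda>i. x i + c * y i) \<in> L"
    and "L \<noteq> topspace (Euclidean_space n)"
  shows "\<exists>a\<in>topspace (Euclidean_space n). a \<noteq> (\<lambda>_. 0) \<and> (\<forall>x\<in>L. dot n a x = 0)"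
  using assms
proof (induction n arbitrary: L)
  case 0
  have X0: "topspace (Euclidean_space 0) = {\<lambda>_. 0}"
    unfolding topspace_Euclidean_space by (rule set_eqI) (simp add: fun_eq_iff)
  have "L = {} \<or> L = {\<lambda>_. 0}"
    using "0.prems"(1) unfolding X0 by (rule subset_singletonD)
  hence False using "0.prems"(2,4) X0 by simp
  thus ?case ..
next
  case (Suc n)
  define L0 where "L0 = {x \<in> L. x n = 0}"
  have L0_sub: "L0 \<subseteq> topspace (Euclidean_space n)"
  proof
    fix x assume x: "x \<in> L0"
    hence "\<And>i. i \<ge> Suc n \<Longrightarrow> x i = 0" "x n = 0"
      using Suc.prems(1) unfolding L0_def topspace_Euclidean_space by blast+
    hence "x i = 0" if "i \<ge> n" for i using that by (cases "i = n") simp_all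
    thus "x \<in> topspace (Euclidean_space n)" by (simp add: topspace_Euclidean_space)
  qed
  show ?case
  proof (cases "\<forall>x\<in>L. x n = 0")
    case True
    define a :: "nat \<Rightarrow> real" where "a = (\<lambda>i. if i = n then 1 else 0)"
    have "a n \<noteq> 0" by (simp add: a_def)
    hence "a \<noteq> (\<lambda>_. 0)" by metis
    moreover have "a \<in> topspace (Euclidean_space (Suc n))"
      by (simp add: a_def topspace_Euclidean_space)
    moreover have "dot (Suc n) a x = 0" if "x \<in> L" for x
      using True that by (simp add: dot_def a_def)
    ultimately show ?thesis by blast
  next
    case False
    then obtain u where u: "u \<in> L" "u n \<noteq> 0" by blast
    have dec: "(\<lambda>i. x i + (- (x n / u n)) * u i) \<in> L0" if "x \<in> L" for x
      using Suc.prems(3)[OF that u(1), of "- (x n / u n)"] u by (simp add: L0_def)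
    have "L0 \<noteq> topspace (Euclidean_space n)"
    proof
      assume eq: "L0 = topspace (Euclidean_space n)"
      have "topspace (Euclidean_space (Suc n)) \<subseteq> L"
      proof
        fix x assume x: "x \<in> topspace (Euclidean_space (Suc n))"
        define y where "y = (\<lambda>i. x i + (- (x n / u n)) * u i)"
        have "y n = 0" using u by (simp add: y_def)
        moreover have "y i = 0" if "i \<ge> Suc n" for i
        proof -
          have "x i = 0" "u i = 0"
            using x subsetD[OF Suc.prems(1) u(1)] that by (simp_all add: topspace_Euclidean_space)
          thus ?thesis by (simp add: y_def)
        qed
        ultimately have "y i = 0" if "i \<ge> n" for i using that by (cases "i = n") simp_all
        hence "y \<in> L0" unfolding eq topspace_Euclidean_space by simp
        hence "y \<in> L" by (simp add: L0_def)
        from Suc.prems(3)[OF this u(1), of "x n / u n"]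
        have "(\<lambda>i. y i + (x n / u n) * u i) \<in> L" .
        thus "x \<in> L" by (simp add: y_def)
      qed
      thus False using Suc.prems(1,4) by simp
    qed
    moreover have "(\<lambda>_. 0) \<in> L0" using Suc.prems(2) by (simp add: L0_def)
    moreover have "(\<lambda>i. x i + c * y i) \<in> L0" if "x \<in> L0" "y \<in> L0" for x y c
      using that Suc.prems(3) by (simp add: L0_def)
    ultimately obtain a where a: "a \<in> topspace (Euclidean_space n)" "a \<noteq> (\<lambda>_. 0)"
        "\<And>x. x \<in> L0 \<Longrightarrow> dot n a x = 0"
      using Suc.IH[OF L0_sub] by metis
    \<comment> \<open>The last coefficient is the one that makes the functional vanish at
      \<open>u\<close>; it leaves the values on \<open>L0\<close> unchanged.\<close>
    define b where "b = a(n := - dot n a u / u n)"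
    have dot_b: "dot (Suc n) b x = dot n a x - dot n a u / u n * x n" for x
      by (simp add: dot_def b_def)
    have "dot (Suc n) b x = 0" if "x \<in> L" for x
    proof -
      have "dot n a (\<lambda>i. x i + (- (x n / u n)) * u i) = dot n a x - x n / u n * dot n a u"
        by (simp add: dot_def algebra_simps sum_subtractf sum_distrib_left)
      thus ?thesis using a(3)[OF dec[OF that]] by (simp add: dot_b)
    qed
    moreover have "b \<noteq> (\<lambda>_. 0)"
    proof
      assume b: "b = (\<lambda>_. 0)"
      have "a i = 0" for i
      proof (cases "i = n")
        case True thus ?thesis using a(1) by (simp add: topspace_Euclidean_space)
      next
        case False thus ?thesis using fun_cong[OF b, of i] by (simp add: b_def)
      qed
      thus False using a(2) by auto
    qed
    moreover have "b \<in> topspace (Euclidean_space (Suc n))"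
      using a(1) by (auto simp: b_def topspace_Euclidean_space)
    ultimately show ?thesis by blast
  qed
qed

section \<open>The support of the measure and a point in its interior\<close>

context log_concave
begin

definition supp :: "(nat \<Rightarrow> real) set" where
  "supp = {x \<in> X. \<forall>r>0. prob (cube n x r) > 0}"

text \<open>Cubes of radius \<open>r\<close> around \<open>x\<close> and \<open>y\<close> combine
  into the cube of radius \<open>r\<close> around the combined point, and the product in the
  log-concavity inequality is positive.\<close>

lemma supp_convex:
  assumes "x \<in> supp" "y \<in> supp" "0 \<le> l" "l \<le> 1"
  shows "comb l x y \<in> supp"
proof (cases "l = 0 \<or> l = 1")
  case True
  thus ?thesis using assms by (auto simp: comb_def)
next
  case False
  have "prob (cube n (comb l x y) r) > 0" if "r > 0" for r
  proof -
    have "prob (cube n x r) > 0" "prob (cube n y r) > 0"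
      using assms that by (simp_all add: supp_def)
    hence "0 < prob (cube n x r) powr l * prob (cube n y r) powr (1 - l)" by simp
    also have "\<dots> \<le> prob (cube n (comb l x y) r)"
    proof (rule prob_comb_ge)
      fix u v assume "u \<in> cube n x r" "v \<in> cube n y r"
      from comb_in_cube[OF this assms(3,4)]
      show "comb l u v \<in> cube n (comb l x y) r" by (simp add: algebra_simps)
    qed (use assms False in auto)
    finally show ?thesis .
  qed
  thus ?thesis using assms by (auto simp: supp_def intro: comb_in_topspace)
qed

lemma supp_average:
  assumes "m > 0" "\<And>j. j < m \<Longrightarrow> p j \<in> supp"
  shows "(\<lambda>i. (\<Sum>j<m. p j i) / real m) \<in> supp"
  using assms
proof (induction m)
  case (Suc m)
  show ?case
  proof (cases "m = 0")
    case True
    thus ?thesis using Suc.prems by simp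
  next
    case False
    have "comb (real m / real (Suc m)) (\<lambda>i. (\<Sum>j<m. p j i) / real m) (p m) \<in> supp"
      using Suc False by (intro supp_convex) auto
    also have "comb (real m / real (Suc m)) (\<lambda>i. (\<Sum>j<m. p j i) / real m) (p m)
        = (\<lambda>i. (\<Sum>j<Suc m. p j i) / real (Suc m))"
    proof
      fix i
      define S b where "S = (\<Sum>j<m. p j i)" and "b = p m i"
      have "real m / real (Suc m) * (S / real m) + (1 - real m / real (Suc m)) * b = (S + b) / real (Suc m)"
        using False by (simp add: divide_simps)
      thus "comb (real m / real (Suc m)) (\<lambda>i. (\<Sum>j<m. p j i) / real m) (p m) i
          = (\<Sum>j<Suc m. p j i) / real (Suc m)"
        by (simp add: comb_def S_def b_def)
    qed
    finally show ?thesis .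
  qed
qed simp

text \<open>By the Lindelof property the complement of the support is null, so a hyperplane
  containing the support would have measure 1.\<close>

lemma supp_not_in_hyperplane:
  assumes "H \<in> hyperplanes n"
  shows "\<not> supp \<subseteq> H"
proof
  assume sub: "supp \<subseteq> H"
  obtain a b where H: "H = {x \<in> X. dot n a x = b}"
    using assms by (auto simp: hyperplanes_def)
  have H_sets: "H \<in> sets \<mu>"
  proof -
    have "closed (dot n a -` {b})"
      by (intro closed_vimage closed_singleton continuous_on_dot)
    moreover have "H = X \<inter> dot n a -` {b}" by (auto simp: H)
    ultimately show ?thesis
      using X_sets by (auto simp: sets_mu intro!: sets.Int borel_closed)
  qed
  \<comment> \<open>Open cubes, because the Lindelof property concerns open covers; each is
    contained in a closed cube of the same radius.\<close>
  define U where "U = (\<lambda>x r. {y. \<forall>i\<in>{..<n}. \<bar>y i - x i\<bar> < r} :: (nat \<Rightarrow> real) set)"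
  have open_U: "open (U x r)" for x r
  proof -
    have "open (\<Inter>i\<in>{..<n}. {y::nat \<Rightarrow> real. \<bar>y i - x i\<bar> < r})"
      by (intro open_INT finite_lessThan ballI open_Collect_less continuous_on_coordinate
          continuous_on_rabs continuous_on_diff continuous_on_const)
    moreover have "U x r = (\<Inter>i\<in>{..<n}. {y. \<bar>y i - x i\<bar> < r})" by (auto simp: U_def)
    ultimately show ?thesis by simp
  qed
  define F where "F = {U x r | x r. x \<in> X \<and> r > 0 \<and> prob (cube n x r) = 0}"
  obtain F' where F': "F' \<subseteq> F" "countable F'" "\<Union>F' = \<Union>F"
    using Lindelof[of F] open_U by (auto simp: F_def)
  have null: "X \<inter> V \<in> null_sets \<mu>" if "V \<in> F" for V
  proof -
    obtain x r where V: "V = U x r" "prob (cube n x r) = 0" using \<open>V \<in> F\<close> by (auto simp: F_def)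
    have "X \<inter> V \<in> sets \<mu>" using open_sets open_U V by simp
    moreover
    have "prob (X \<inter> V) \<le> prob (cube n x r)"
      by (rule finite_measure_mono[OF _ cube_sets]) (auto simp: V U_def cube_def less_imp_le)
    hence "prob (X \<inter> V) = 0" using V(2) by (intro antisym) auto
    ultimately show ?thesis by (auto simp: null_sets_def emeasure_eq_measure)
  qed
  have "(\<Union>V\<in>F'. X \<inter> V) \<in> null_sets \<mu>"
    using F' null by (intro null_sets_UN') auto
  moreover have "X - H \<subseteq> (\<Union>V\<in>F'. X \<inter> V)"
  proof
    fix x assume x: "x \<in> X - H"
    hence "x \<notin> supp" using sub by auto
    then obtain r where r: "r > 0" "\<not> prob (cube n x r) > 0" using x by (auto simp: supp_def)
    hence "prob (cube n x r) = 0" using measure_nonneg[of \<mu> "cube n x r"] by linarith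
    hence "U x r \<in> F" using x r by (auto simp: F_def)
    moreover have "x \<in> U x r" using r by (simp add: U_def)
    ultimately have "x \<in> \<Union>F'" unfolding F'(3) by blast
    thus "x \<in> (\<Union>V\<in>F'. X \<inter> V)" using x by auto
  qed
  ultimately have "X - H \<in> null_sets \<mu>"
    using H_sets X_sets by (metis null_sets_subset sets.Diff)
  hence "prob (X - H) = 0" by (simp add: measure_eq_0_null_sets)
  hence "prob H = 1"
    using prob_compl[OF H_sets] by (simp add: space_mu)
  moreover have "prob H < 1" using log_concave assms by (auto simp: log_concave_prob_def)
  ultimately show False by simp
qed

text \<open>The cone \<open>L\<close> over the differences of support points is a linear subspace,
  because the support is convex. If it were proper, a nonzero functional would vanish on it, hence
  be constant on the support, which would then lie in a hyperplane.\<close>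

lemma scaled_difference_of_supp:
  assumes "n \<ge> 1" "x \<in> X"
  shows "\<exists>p\<in>supp. \<exists>q\<in>supp. \<exists>c\<ge>0. x = (\<lambda>i. c * (p i - q i))"
proof (rule ccontr)
  assume no: "\<not> ?thesis"
  define L where "L = {\<lambda>i. c * (p i - q i) | p q c. p \<in> supp \<and> q \<in> supp \<and> c \<ge> 0}"
  have sX: "supp \<subseteq> X" by (auto simp: supp_def)
  \<comment> \<open>Any hyperplane would do: one is needed only to see that the support is
    nonempty.\<close>
  define e :: "nat \<Rightarrow> real" where "e = (\<lambda>i. if i = 0 then 1 else 0)"
  have "e \<in> X" "e 0 \<noteq> 0"
    using assms(1) by (simp_all add: e_def topspace_Euclidean_space)
  hence e: "e \<in> X" "e \<noteq> (\<lambda>_. 0)" by metis+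
  hence "{x \<in> X. dot n e x = 0} \<in> hyperplanes n"
    by (auto simp: hyperplanes_def)
  then obtain w where w: "w \<in> supp" using supp_not_in_hyperplane by fastforce
  have add: "(\<lambda>i. c * (p i - q i) + d * (p' i - q' i)) \<in> L"
    if "p \<in> supp" "q \<in> supp" "p' \<in> supp" "q' \<in> supp" "c \<ge> 0" "d \<ge> 0" for p q p' q' c d
  proof (cases "c + d = 0")
    case True
    hence "c = 0" "d = 0" using that by auto
    thus ?thesis unfolding L_def mem_Collect_eq using w
      by (intro exI[of _ w] exI[of _ "0::real"]) auto
  next
    case False
    have eq: "c + d > 0" using that False by simp
    have "(\<lambda>i. c * (p i - q i) + d * (p' i - q' i)) =
      (\<lambda>i. (c + d) * (comb (c / (c + d)) p p' i - comb (c / (c + d)) q q' i))"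
    proof
      fix i
      have l: "(c + d) * (c / (c + d)) = c" "(c + d) * (1 - c / (c + d)) = d"
        using eq by (auto simp: field_simps)
      have "(c + d) * (comb (c / (c + d)) p p' i - comb (c / (c + d)) q q' i)
        = ((c + d) * (c / (c + d))) * (p i - q i) + ((c + d) * (1 - c / (c + d))) * (p' i - q' i)"
        unfolding comb_def by algebra
      thus "c * (p i - q i) + d * (p' i - q' i) =
        (c + d) * (comb (c / (c + d)) p p' i - comb (c / (c + d)) q q' i)" by (simp only: l)
    qed
    moreover have "comb (c / (c + d)) p p' \<in> supp" "comb (c / (c + d)) q q' \<in> supp"
      using that eq by (auto intro!: supp_convex)
    ultimately show ?thesis unfolding L_def mem_Collect_eq using that by fastforce
  qed
  have "L \<subseteq> X"
  proof
    fix y assume "y \<in> L"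
    then obtain p q c where "y = (\<lambda>i. c * (p i - q i))" "p \<in> X" "q \<in> X"
      using sX by (auto simp: L_def)
    thus "y \<in> X" by (simp add: topspace_Euclidean_space)
  qed
  moreover have "(\<lambda>_. 0) \<in> L" using add[OF w w w w, of 0 0] by simp
  moreover have "(\<lambda>i. x i + c * y i) \<in> L" if xy: "x \<in> L" "y \<in> L" for x y c
  proof -
    obtain p q d where x: "x = (\<lambda>i. d * (p i - q i))" "p \<in> supp" "q \<in> supp" "d \<ge> 0"
      using xy by (auto simp: L_def)
    obtain p' q' d' where y: "y = (\<lambda>i. d' * (p' i - q' i))" "p' \<in> supp" "q' \<in> supp" "d' \<ge> 0"
      using xy by (auto simp: L_def)
    show ?thesis
    proof (cases "c \<ge> 0")
      case True
      thus ?thesis using add[OF x(2,3) y(2,3) x(4), of "c * d'"] y(4)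
        by (simp add: x(1) y(1) mult.assoc)
    next
      case False
      hence "- c * d' \<ge> 0" using y(4) by (simp add: mult_nonpos_nonneg)
      thus ?thesis using add[OF x(2,3) y(3,2) x(4), of "- c * d'"]
        by (simp add: x(1) y(1) algebra_simps)
    qed
  qed
  moreover have "L \<noteq> X"
  proof
    assume "L = X"
    with assms(2) have "x \<in> L" by simp
    thus False using no by (auto simp: L_def)
  qed
  ultimately obtain a where a: "a \<in> X" "a \<noteq> (\<lambda>_. 0)" "\<And>x. x \<in> L \<Longrightarrow> dot n a x = 0"
    using proper_subspace_orthogonal[of L n] by blast
  have "dot n a p = dot n a w" if "p \<in> supp" for p
  proof -
    have "(\<lambda>i. p i - w i) \<in> L" using add[OF that w w w, of 1 0] by simp
    hence "dot n a (\<lambda>i. p i - w i) = 0" by (rule a(3))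
    thus ?thesis by (simp add: dot_def algebra_simps sum_subtractf)
  qed
  hence "supp \<subseteq> {x \<in> X. dot n a x = dot n a w}" using sX by auto
  moreover have "{x \<in> X. dot n a x = dot n a w} \<in> hyperplanes n"
    using a by (auto simp: hyperplanes_def)
  ultimately show False using supp_not_in_hyperplane by blast
qed

text \<open>Write each unit vector as \<open>c i\<close> times a difference of support points
  \<open>p i\<close> and \<open>q i\<close>, and let \<open>z\<close> be the average of the
  \<open>n\<close> midpoints. Replacing the \<open>i\<close>-th midpoint by \<open>p i\<close> or
  \<open>q i\<close> keeps the average in the support and moves it along the \<open>i\<close>-th
  axis only.\<close>

lemma supp_interior_point:
  assumes "n \<ge> 1"
  obtains z s where "z \<in> supp" "s > 0"
    "\<And>i. i < n \<Longrightarrow> \<exists>d\<ge>s. z(i := z i + d) \<in> supp \<and> z(i := z i - d) \<in> supp"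
proof -
  define e :: "nat \<Rightarrow> nat \<Rightarrow> real" where "e = (\<lambda>i j. if j = i then 1 else 0)"
  define P where "P = (\<lambda>i (p, q, c). p \<in> supp \<and> q \<in> supp \<and> c \<ge> 0 \<and> e i = (\<lambda>j. c * (p j - q j)))"
  have "\<exists>t. P i t" if "i < n" for i
  proof -
    have "e i \<in> X" using that by (simp add: e_def topspace_Euclidean_space)
    from scaled_difference_of_supp[OF assms this] show ?thesis
      unfolding P_def by fast
  qed
  hence "\<forall>i\<in>{..<n}. \<exists>t. P i t" by simp
  from bchoice[OF this] obtain f where f: "\<And>i. i < n \<Longrightarrow> P i (f i)" by auto
  define p q c where "p = (\<lambda>i. fst (f i))" and "q = (\<lambda>i. fst (snd (f i)))" and "c = (\<lambda>i. snd (snd (f i)))"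
  have pqc: "p i \<in> supp" "q i \<in> supp" "c i \<ge> 0" "e i = (\<lambda>j. c i * (p i j - q i j))" if "i < n" for i
    using f[OF that] by (auto simp: P_def p_def q_def c_def split: prod.splits)
  have c_pos: "c i > 0" if "i < n" for i
  proof -
    have "e i i = 1" by (simp add: e_def)
    hence "c i \<noteq> 0" using pqc(4)[OF that] by auto
    thus ?thesis using pqc(3)[OF that] by simp
  qed
  define m where "m = (\<lambda>i. comb (1/2) (p i) (q i))"
  have m: "m i \<in> supp" if "i < n" for i
    unfolding m_def using that pqc(1,2) by (intro supp_convex) auto
  define z where "z = (\<lambda>k. (\<Sum>j<n. m j k) / real n)"
  \<comment> \<open>Half of \<open>p i - q i\<close> is the unit vector divided by
    \<open>2 * c i\<close>, and averaging divides by \<open>n\<close> once more.\<close>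
  define d where "d = (\<lambda>i. 1 / (2 * real n * c i))"
  have d_pos: "d i > 0" if "i < n" for i
    using c_pos[OF that] assms by (simp add: d_def)
  have z: "z \<in> supp" unfolding z_def using assms m by (intro supp_average) auto
  have avg: "(\<lambda>k. (\<Sum>j<n. (m(i := v)) j k) / real n) = (\<lambda>k. z k + (v k - m i k) / real n)"
    if "i < n" for i v
  proof
    fix k
    have "(\<Sum>j<n. (m(i := v)) j k) = v k + (\<Sum>j\<in>{..<n} - {i}. m j k)"
      using that by (subst sum.remove[of _ i]) (auto intro!: sum.cong)
    moreover have "(\<Sum>j<n. m j k) = m i k + (\<Sum>j\<in>{..<n} - {i}. m j k)"
      using that by (subst sum.remove[of _ i]) auto
    ultimately show "(\<Sum>j<n. (m(i := v)) j k) / real n = z k + (v k - m i k) / real n"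
      by (simp add: z_def diff_divide_distrib add_divide_distrib)
  qed
  have diff: "p i k - q i k = e i k / c i" if "i < n" for i k
    using fun_cong[OF pqc(4)[OF that], of k] c_pos[OF that] by simp
  have pm: "z(i := z i + d i) \<in> supp \<and> z(i := z i - d i) \<in> supp" if i: "i < n" for i
  proof -
    have "(\<lambda>k. z k + (p i k - m i k) / real n) \<in> supp" "(\<lambda>k. z k + (q i k - m i k) / real n) \<in> supp"
    proof -
      have "(m(i := p i)) j \<in> supp" "(m(i := q i)) j \<in> supp" if "j < n" for j
        using m[OF that] pqc(1,2)[OF i] by simp_all
      thus "(\<lambda>k. z k + (p i k - m i k) / real n) \<in> supp" "(\<lambda>k. z k + (q i k - m i k) / real n) \<in> supp"
        unfolding avg[OF i, symmetric] using assms by (auto intro: supp_average simp del: fun_upd_apply)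
    qed
    moreover have "p i k - m i k = (p i k - q i k) / 2" "q i k - m i k = - (p i k - q i k) / 2" for k
      by (auto simp: m_def comb_def field_simps)
    hence "(\<lambda>k. z k + (p i k - m i k) / real n) = z(i := z i + d i)"
      "(\<lambda>k. z k + (q i k - m i k) / real n) = z(i := z i - d i)"
      unfolding fun_eq_iff by (simp_all add: diff[OF i] e_def d_def)
    ultimately show ?thesis by simp
  qed
  show ?thesis
  proof (rule that[OF z, of "Min (d ` {..<n})"])
    show "0 < Min (d ` {..<n})"
      using assms d_pos by (subst Min_gr_iff) (auto simp: lessThan_empty_iff)
    show "\<exists>t\<ge>Min (d ` {..<n}). z(i := z i + t) \<in> supp \<and> z(i := z i - t) \<in> supp" if "i < n" for i
    proof (intro exI conjI)
      show "d i \<ge> Min (d ` {..<n})" using that by (intro Min_le) auto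
    qed (use pm[OF that] in blast)+
  qed
qed

text \<open>The sets \<open>B\<close> are cubes of radius \<open>k\<close> around the support points
  displaced from the centre along the axes. There are finitely many of them, so their measures have
  a common positive lower bound \<open>\<delta>\<close>, uniform in the direction
  \<open>a\<close>.\<close>

lemma central_point:
  assumes "n \<ge> 1"
  obtains z k \<delta> where "z \<in> supp" "k > 0" "0 < \<delta>" "\<delta> \<le> 1"
    "\<And>a. a \<in> X \<Longrightarrow> \<exists>B\<in>sets \<mu>. prob B \<ge> \<delta> \<and> (\<forall>x\<in>B. dot n a x \<ge> dot n a z + k * norm1 n a)"
proof -
  obtain z s where z: "z \<in> supp" "s > 0"
    "\<And>i. i < n \<Longrightarrow> \<exists>d\<ge>s. z(i := z i + d) \<in> supp \<and> z(i := z i - d) \<in> supp"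
    using supp_interior_point[OF assms] by blast
  then obtain d where d: "\<And>i. i < n \<Longrightarrow> d i \<ge> s" "\<And>i. i < n \<Longrightarrow> z(i := z i + d i) \<in> supp"
      "\<And>i. i < n \<Longrightarrow> z(i := z i - d i) \<in> supp"
    by metis
  \<comment> \<open>With \<open>i\<close> maximizing \<open>\<bar>a i\<bar>\<close>, the
    displacement gains at least \<open>s * \<bar>a i\<bar>\<close>, which is at least
    \<open>2 * k * norm1 n a\<close>; the cube loses at most half of that.\<close>
  define k where "k = s / (2 * real n)"
  have k: "k > 0" using z assms by (simp add: k_def)
  define v where "v = (\<lambda>(b, i). z(i := z i + (if b then d i else - d i)))"
  have v: "v (b, i) \<in> supp" if "i < n" for b i
    using d(2,3)[OF that] by (simp add: v_def)
  define \<delta> where "\<delta> = Min ((\<lambda>j. prob (cube n (v j) k)) ` (UNIV \<times> {..<n}))"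
  have fin: "finite ((UNIV :: bool set) \<times> {..<n})" "(UNIV :: bool set) \<times> {..<n} \<noteq> {}"
    using assms by (auto simp: lessThan_empty_iff)
  have \<delta>_le: "\<delta> \<le> prob (cube n (v (b, i)) k)" if "i < n" for b i
    unfolding \<delta>_def using that fin by (intro Min_le) auto
  have \<delta>_pos: "\<delta> > 0"
    unfolding \<delta>_def using fin v k by (subst Min_gr_iff) (auto simp: supp_def)
  have "\<delta> \<le> 1" using \<delta>_le[of 0 True] assms prob_le_1 order_trans by fastforce
  moreover have "\<exists>B\<in>sets \<mu>. prob B \<ge> \<delta> \<and> (\<forall>x\<in>B. dot n a x \<ge> dot n a z + k * norm1 n a)" if a: "a \<in> X" for a
  proof -
    define M where "M = Max ((\<lambda>i. \<bar>a i\<bar>) ` {..<n})"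
    have "M \<in> (\<lambda>i. \<bar>a i\<bar>) ` {..<n}"
      unfolding M_def using assms by (intro Max_in) (auto simp: lessThan_empty_iff)
    then obtain i where i: "i < n" "M = \<bar>a i\<bar>" by auto
    have M: "\<bar>a j\<bar> \<le> \<bar>a i\<bar>" if "j < n" for j
      unfolding i(2)[symmetric] M_def using that by (intro Max_ge) auto
    have "norm1 n a \<le> real n * \<bar>a i\<bar>"
      unfolding norm1_def using sum_bounded_above[of "{..<n}" "\<lambda>j. \<bar>a j\<bar>" "\<bar>a i\<bar>"] M by simp
    hence "2 * k * norm1 n a \<le> 2 * k * (real n * \<bar>a i\<bar>)" using k by (intro mult_left_mono) auto
    also have "\<dots> = s * \<bar>a i\<bar>" using assms by (simp add: k_def)
    also have "\<dots> \<le> d i * \<bar>a i\<bar>" using d(1)[OF i(1)] by (intro mult_right_mono) auto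
    finally have le: "2 * k * norm1 n a \<le> d i * \<bar>a i\<bar>" .
    define b where "b = (a i \<ge> 0)"
    have upd: "dot n a (z(i := z i + t)) = dot n a z + a i * t" for t
    proof -
      have "dot n a (z(i := z i + t)) = a i * (z i + t) + (\<Sum>j\<in>{..<n} - {i}. a j * z j)"
        unfolding dot_def using i(1) by (subst sum.remove[of _ i]) (auto intro!: sum.cong)
      moreover have "dot n a z = a i * z i + (\<Sum>j\<in>{..<n} - {i}. a j * z j)"
        unfolding dot_def using i(1) by (subst sum.remove[of _ i]) auto
      ultimately show ?thesis by (simp add: algebra_simps)
    qed
    have dv: "dot n a (v (b, i)) = dot n a z + d i * \<bar>a i\<bar>"
      using upd[of "d i"] upd[of "- d i"] by (auto simp: v_def b_def)
    have "dot n a x \<ge> dot n a z + k * norm1 n a" if "x \<in> cube n (v (b, i)) k" for x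
    proof -
      have "\<bar>dot n a x - dot n a (v (b, i))\<bar> \<le> k * norm1 n a"
        using that by (intro abs_dot_diff_le) (auto simp: cube_def)
      thus ?thesis using dv le by simp
    qed
    thus ?thesis using \<delta>_le[OF i(1)] by (intro bexI[of _ "cube n (v (b, i)) k"]) auto
  qed
  ultimately show ?thesis using that[of z k \<delta>] z k \<delta>_pos by blast
qed

text \<open>Cut the cube of radius \<open>R\<close> by a grid of mesh \<open>\<eta>\<close>. At most
  \<open>(5 * R / \<eta>) ^ n\<close> cells meet \<open>A\<close>, and each of these lies in the
  cube of radius \<open>\<eta>\<close> around any of its points. The centre can therefore be taken
  in \<open>A\<close>.\<close>

lemma cube_pigeonhole:
  assumes "A \<in> sets \<mu>" "A \<subseteq> cube n z R" "A \<noteq> {}" "0 < \<eta>" "\<eta> \<le> R"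
  obtains y where "y \<in> A" "prob (A \<inter> cube n y \<eta>) \<ge> prob A * (\<eta> / (5 * R)) ^ n"
proof (rule ccontr)
  assume "\<not> thesis"
  hence less: "prob (A \<inter> cube n y \<eta>) < prob A * (\<eta> / (5 * R)) ^ n" if "y \<in> A" for y
    using that \<open>\<And>y. y \<in> A \<Longrightarrow> prob A * (\<eta> / (5 * R)) ^ n \<le> prob (A \<inter> cube n y \<eta>) \<Longrightarrow> thesis\<close>
    by (meson not_le)
  define g where "g = (\<lambda>x. restrict (\<lambda>i. \<lfloor>(x i - z i) / \<eta>\<rfloor>) {..<n})"
  define I where "I = {\<lfloor>- (R / \<eta>)\<rfloor>..\<lfloor>R / \<eta>\<rfloor>}"
  have "g ` A \<subseteq> PiE {..<n} (\<lambda>_. I)"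
  proof (rule image_subsetI)
    fix x assume "x \<in> A"
    hence x: "\<bar>x i - z i\<bar> \<le> R" if "i < n" for i using assms(2) that by (auto simp: cube_def)
    have "\<lfloor>(x i - z i) / \<eta>\<rfloor> \<in> I" if "i < n" for i
    proof -
      have "- R \<le> x i - z i" "x i - z i \<le> R" using x[OF that] by auto
      hence "- (R / \<eta>) \<le> (x i - z i) / \<eta>" "(x i - z i) / \<eta> \<le> R / \<eta>"
        using assms(4) divide_right_mono[of "- R" "x i - z i" \<eta>] divide_right_mono[of "x i - z i" R \<eta>]
        by simp_all
      thus ?thesis unfolding I_def by (auto intro: floor_mono)
    qed
    thus "g x \<in> PiE {..<n} (\<lambda>_. I)" by (simp add: g_def)
  qed
  moreover have fin: "finite (PiE {..<n} (\<lambda>_. I))" by (intro finite_PiE) (auto simp: I_def)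
  ultimately have fin_g: "finite (g ` A)" and "card (g ` A) \<le> card (PiE {..<n} (\<lambda>_. I))"
    by (auto intro: finite_subset card_mono)
  hence card_g: "real (card (g ` A)) \<le> real (card I) ^ n" by (simp add: card_PiE flip: of_nat_power)
  \<comment> \<open>There are at most \<open>2 * R / \<eta> + 2\<close> indices per axis;
    \<open>\<eta> \<le> R\<close> absorbs the 2.\<close>
  have "real (card I) \<le> 5 * R / \<eta>"
  proof -
    have "R / \<eta> \<ge> 1" using assms by simp
    moreover have "real_of_int \<lfloor>R / \<eta>\<rfloor> \<le> R / \<eta>" "real_of_int \<lfloor>- (R / \<eta>)\<rfloor> > - (R / \<eta>) - 1"
      by linarith+
    moreover have "real (card I) = max 0 (real_of_int (\<lfloor>R / \<eta>\<rfloor> - \<lfloor>- (R / \<eta>)\<rfloor> + 1))"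
      by (simp add: I_def)
    ultimately have "real (card I) \<le> 5 * (R / \<eta>)" unfolding of_int_add of_int_diff of_int_1 by linarith
    thus ?thesis by simp
  qed
  hence "real (card I) ^ n \<le> (5 * R / \<eta>) ^ n" by (intro power_mono) auto
  with card_g have card: "real (card (g ` A)) \<le> (5 * R / \<eta>) ^ n" by linarith
  have "\<forall>v\<in>g ` A. \<exists>y. y \<in> A \<and> g y = v" by auto
  from bchoice[OF this] obtain h where h: "\<And>v. v \<in> g ` A \<Longrightarrow> h v \<in> A \<and> g (h v) = v" by auto
  have "A \<subseteq> (\<Union>v\<in>g ` A. A \<inter> cube n (h v) \<eta>)"
  proof
    fix x assume x: "x \<in> A"
    define y where "y = h (g x)"
    have y: "g y = g x" using h[of "g x"] x by (auto simp: y_def)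
    have "\<bar>x i - y i\<bar> \<le> \<eta>" if "i < n" for i
    proof -
      have "\<lfloor>(x i - z i) / \<eta>\<rfloor> = \<lfloor>(y i - z i) / \<eta>\<rfloor>"
        using fun_cong[OF y, of i] that by (simp add: g_def)
      hence "\<bar>(x i - z i) / \<eta> - (y i - z i) / \<eta>\<bar> \<le> 1" by linarith
      also have "(x i - z i) / \<eta> - (y i - z i) / \<eta> = (x i - y i) / \<eta>"
        by (simp add: diff_divide_distrib)
      finally show ?thesis using assms(4) by (simp add: abs_divide)
    qed
    hence "x \<in> cube n y \<eta>" using x assms(2) by (auto simp: cube_def)
    thus "x \<in> (\<Union>v\<in>g ` A. A \<inter> cube n (h v) \<eta>)" using x by (auto simp: y_def)
  qed
  hence "prob A \<le> prob (\<Union>v\<in>g ` A. A \<inter> cube n (h v) \<eta>)"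
    using assms(1) fin_g by (intro finite_measure_mono sets.finite_UN) auto
  also have "\<dots> \<le> (\<Sum>v\<in>g ` A. prob (A \<inter> cube n (h v) \<eta>))"
    using assms(1) fin_g by (intro finite_measure_subadditive_finite) auto
  also have "\<dots> < (\<Sum>v\<in>g ` A. prob A * (\<eta> / (5 * R)) ^ n)"
    using fin_g assms(3) h less by (intro sum_strict_mono) auto
  also have "\<dots> = real (card (g ` A)) * (prob A * (\<eta> / (5 * R)) ^ n)" by simp
  also have "\<dots> \<le> (5 * R / \<eta>) ^ n * (prob A * (\<eta> / (5 * R)) ^ n)"
    using card assms by (intro mult_right_mono mult_nonneg_nonneg) auto
  also have "\<dots> = prob A * ((5 * R / \<eta>) * (\<eta> / (5 * R))) ^ n"
    unfolding power_mult_distrib by (simp only: mult_ac)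
  also have "\<dots> = prob A" using assms(4,5) by simp
  finally show False by simp
qed

section \<open>Borell's tail estimate\<close>

lemma prob_cube_limit:
  "(\<lambda>k. prob (cube n z (real k))) \<longlonglongrightarrow> 1"
proof -
  have "incseq (\<lambda>k. cube n z (real k))"
    by (rule incseq_SucI) (force simp: cube_def)
  hence "(\<lambda>k. prob (cube n z (real k))) \<longlonglongrightarrow> prob (\<Union>k. cube n z (real k))"
    by (intro finite_Lim_measure_incseq) auto
  also have "(\<Union>k. cube n z (real k)) = X"
  proof (intro equalityI subsetI)
    fix x assume x: "x \<in> X"
    obtain k where k: "(\<Sum>i<n. \<bar>x i - z i\<bar>) \<le> real k" using real_arch_simple by blast
    have "\<bar>x i - z i\<bar> \<le> real k" if "i < n" for i
      using member_le_sum[of i "{..<n}" "\<lambda>i. \<bar>x i - z i\<bar>"] that k by simp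
    thus "x \<in> (\<Union>k. cube n z (real k))" using x by (auto simp: cube_def)
  qed (auto simp: cube_def)
  finally show ?thesis by (simp add: prob_X)
qed

text \<open>Fix a cube of measure above 2/3. Combining it with the outside of a larger cube, with
  suitable weights, gives only points outside the fixed cube, which have measure below 1/3. This
  forces exponential decay in \<open>R\<close>, of which only the rate \<open>1 / R\<close> is
  kept.\<close>

lemma tail_bound:
  assumes "z \<in> X"
  obtains C where "C > 0" "\<And>R. R > 0 \<Longrightarrow> prob (X - cube n z R) \<le> C / R"
proof -
  have "\<forall>\<^sub>F k in sequentially. prob (cube n z (real k)) > 2/3"
    using order_tendstoD(1)[OF prob_cube_limit, of "2/3"] by simp
  moreover have "\<forall>\<^sub>F k::nat in sequentially. k > 0" by (rule eventually_gt_at_top)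
  ultimately obtain k :: nat where "prob (cube n z (real k)) > 2/3" "k > 0"
    using eventually_happens'[OF sequentially_bot eventually_conj] by blast
  then obtain \<rho> :: real where \<rho>: "\<rho> > 0" "prob (cube n z \<rho>) > 2/3" by (metis of_nat_0_less_iff)
  have "prob (X - cube n z R) \<le> 4 * \<rho> / R" if R: "R > 0" for R
  proof (cases "R \<le> \<rho>")
    case True
    have "prob (X - cube n z R) \<le> 1" by simp
    also have "1 \<le> 4 * \<rho> / R" using True R \<rho> by simp
    finally show ?thesis .
  next
    case False
    define s where "s = R / \<rho>"
    have s: "s > 1" "R = s * \<rho>" using False \<rho> by (simp_all add: s_def)
    \<comment> \<open>Chosen so that \<open>l * s - (1 - l) = 1\<close>: a coordinate deviation
      above \<open>s * \<rho>\<close> survives as one above \<open>\<rho>\<close>.\<close>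
    define l where "l = 2 / (s + 1)"
    have "s + 1 \<noteq> 0" using s by simp
    hence "l * (s + 1) = 2" by (metis l_def nonzero_eq_divide_eq)
    with s have l: "0 < l" "l < 1" "l * (s + 1) = 2" by (simp_all add: l_def)
    have l': "l * s - (1 - l) = 1" using l(3) by (simp add: algebra_simps)
    define a where "a = prob (X - cube n z R)"
    have "a powr l * prob (cube n z \<rho>) powr (1 - l) \<le> prob (X - cube n z \<rho>)"
      unfolding a_def
    proof (rule prob_comb_ge)
      fix x y assume xy: "x \<in> X - cube n z R" "y \<in> cube n z \<rho>"
      then obtain i where i: "i < n" "\<bar>x i - z i\<bar> > R" by (auto simp: cube_def not_le)
      have "l * R < l * \<bar>x i - z i\<bar>" using i l by simp
      moreover have "(1 - l) * \<bar>y i - z i\<bar> \<le> (1 - l) * \<rho>"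
        using xy i l by (intro mult_left_mono) (auto simp: cube_def)
      moreover have "\<bar>l * (x i - z i) + (1 - l) * (y i - z i)\<bar> \<ge> l * \<bar>x i - z i\<bar> - (1 - l) * \<bar>y i - z i\<bar>"
        using l abs_triangle_ineq2[of "l * (x i - z i)" "- ((1 - l) * (y i - z i))"]
        by (simp add: abs_mult)
      moreover have "l * R - (1 - l) * \<rho> = (l * s - (1 - l)) * \<rho>"
        unfolding s(2) by (simp add: algebra_simps)
      moreover have "comb l x y i - z i = l * (x i - z i) + (1 - l) * (y i - z i)"
        by (simp add: comb_def algebra_simps)
      ultimately have "\<bar>comb l x y i - z i\<bar> > \<rho>" unfolding l' by simp
      moreover have "comb l x y \<in> X" using xy by (intro comb_in_topspace) (auto simp: cube_def)
      ultimately show "comb l x y \<in> X - cube n z \<rho>" using i by (auto simp: cube_def not_le)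
    qed (use l X_sets in auto)
    also have "prob (X - cube n z \<rho>) = 1 - prob (cube n z \<rho>)"
      using prob_compl[OF cube_sets] by (simp add: space_mu)
    finally have le: "a powr l * prob (cube n z \<rho>) powr (1 - l) \<le> 1/3" using \<rho> by simp
    have "(2/3::real) \<le> (2/3) powr (1 - l)"
      using powr_mono'[of "1 - l" 1 "2/3 :: real"] l by simp
    also have "\<dots> \<le> prob (cube n z \<rho>) powr (1 - l)"
      using \<rho> l by (intro powr_mono2) auto
    finally have "a powr l * (2/3) \<le> a powr l * prob (cube n z \<rho>) powr (1 - l)"
      by (intro mult_left_mono) auto
    hence al: "a powr l \<le> 1/2" using le by simp
    show ?thesis
    proof (cases "a = 0")
      case True
      thus ?thesis using R \<rho> by (simp add: a_def)
    next
      case False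
      hence a: "a > 0" by (simp add: a_def zero_less_measure_iff)
      have "ln (a powr l) \<le> ln (1/2)" using al a by (subst ln_le_cancel_iff) auto
      hence "l * ln a \<le> - ln 2" using a by (simp add: ln_powr ln_div)
      hence "ln 2 \<le> l * (- ln a)" by simp
      hence "(s + 1) * ln 2 \<le> (s + 1) * (l * (- ln a))" using s by (intro mult_left_mono) auto
      also have "\<dots> = (l * (s + 1)) * (- ln a)" by (simp only: mult_ac)
      finally have "(s + 1) * ln 2 \<le> 2 * (- ln a)" unfolding l(3) .
      moreover have "s * (1/2) \<le> (s + 1) * ln 2"
        using s ln2_ge_two_thirds by (intro mult_mono) auto
      \<comment> \<open>Here the exponential decay is given up for a bound of order
        \<open>1 / s\<close>.\<close>
      moreover have "- ln a \<le> 1 / a"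
        using ln_le_minus_one[of "1 / a"] a by (simp add: ln_div)
      ultimately have "s \<le> 4 * (1 / a)" by simp
      hence "a \<le> 4 / s" using a s by (simp add: field_simps)
      also have "4 / s = 4 * \<rho> / R" using \<rho> R by (simp add: s_def)
      finally show ?thesis by (simp add: a_def)
    qed
  qed
  thus ?thesis using that[of "4 * \<rho>"] \<rho> by simp
qed

section \<open>Half-spaces of small measure and the shallow region\<close>

definition half :: "(nat \<Rightarrow> real) \<Rightarrow> real \<Rightarrow> (nat \<Rightarrow> real) set" where
  "half a b = {x \<in> X. dot n a x > b}"

lemma half_sets: "half a b \<in> sets \<mu>"
proof -
  have "open {x. dot n a x > b}"
    by (intro open_Collect_less continuous_on_dot continuous_on_const)
  hence "X \<inter> {x. dot n a x > b} \<in> sets \<mu>" by (rule open_sets)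
  thus ?thesis by (simp add: half_def Collect_conj_eq)
qed

definition shallow :: "real \<Rightarrow> (nat \<Rightarrow> real) set" where
  "shallow t = {x \<in> X. \<exists>a b. a \<in> X \<and> a \<noteq> (\<lambda>_. 0) \<and> prob (half a b) < t \<and> x \<in> half a b}"

text \<open>A union of open half-spaces is relatively open however many there are, so
  \<open>shallow t\<close> is measurable although the union is uncountable.\<close>

lemma shallow_open:
  obtains U where "open U" "shallow t = X \<inter> U"
proof (rule that)
  let ?U = "\<Union>(a, b)\<in>{(a, b). a \<in> X \<and> a \<noteq> (\<lambda>_. 0) \<and> prob (half a b) < t}. {x. dot n a x > b}"
  show "open ?U"
    by (auto intro!: open_UN open_Collect_less continuous_on_dot continuous_on_const)
  show "shallow t = X \<inter> ?U" unfolding shallow_def half_def by blast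
qed

text \<open>Some closed half-space through \<open>x\<close> has measure below \<open>t\<close>. It
  is the decreasing limit of slightly larger open half-spaces, so by continuity from above one of
  these has measure below \<open>t\<close> too.\<close>

lemma depth_less_imp_shallow:
  assumes "n \<ge> 1" "x \<in> X" "halfspace_depth n \<mu> x < t"
  shows "x \<in> shallow t"
proof -
  let ?Hs = "{H \<in> closed_halfspaces n. x \<in> H}"
  \<comment> \<open>A unit vector shows that some closed half-space contains \<open>x\<close>, so
    the infimum is over a nonempty family.\<close>
  define e :: "nat \<Rightarrow> real" where "e = (\<lambda>i. if i = 0 then 1 else 0)"
  have "e \<in> X" "e 0 \<noteq> 0" using assms(1) by (simp_all add: e_def topspace_Euclidean_space)
  hence "e \<in> X" "e \<noteq> (\<lambda>_. 0)" by metis+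
  hence "{y \<in> X. dot n e y \<ge> dot n e x} \<in> ?Hs"
    using assms(2) by (auto simp: closed_halfspaces_def)
  hence "?Hs \<noteq> {}" by blast
  moreover have "bdd_below (measure \<mu> ` ?Hs)" by (rule bdd_belowI2[of _ 0]) simp
  ultimately obtain H where H: "H \<in> ?Hs" "prob H < t"
    using assms(3) unfolding halfspace_depth_def by (subst (asm) cINF_less_iff) auto
  then obtain a b where ab: "H = {y \<in> X. dot n a y \<ge> b}" "a \<in> X" "a \<noteq> (\<lambda>_. 0)"
    by (auto simp: closed_halfspaces_def)
  define h where "h = (\<lambda>k. half a (b - 1 / real (Suc k)))"
  have "decseq h"
  proof (rule decseq_SucI)
    fix k
    have "1 / real (Suc (Suc k)) \<le> 1 / real (Suc k)" by (simp add: frac_le)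
    thus "h (Suc k) \<subseteq> h k" by (auto simp: h_def half_def)
  qed
  hence "(\<lambda>k. prob (h k)) \<longlonglongrightarrow> prob (\<Inter>k. h k)"
    using half_sets by (intro finite_Lim_measure_decseq) (auto simp: h_def)
  also have "(\<Inter>k. h k) = H"
  proof (intro equalityI subsetI)
    fix y assume "y \<in> H"
    hence "y \<in> X" "dot n a y \<ge> b" by (auto simp: ab)
    moreover have "b - 1 / real (Suc k) < b" for k by simp
    ultimately have "y \<in> h k" for k unfolding h_def half_def by (blast intro: less_le_trans)
    thus "y \<in> (\<Inter>k. h k)" by blast
  next
    fix y assume y: "y \<in> (\<Inter>k. h k)"
    hence yk: "y \<in> X" "b - 1 / real (Suc k) \<le> dot n a y" for k
      by (auto simp: h_def half_def less_imp_le)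
    have "(\<lambda>k. b - 1 / real (Suc k)) \<longlonglongrightarrow> b - 0"
      by (intro tendsto_diff tendsto_const LIMSEQ_Suc[OF lim_1_over_n])
    hence "b \<le> dot n a y" using LIMSEQ_le_const2[of _ "b - 0" "dot n a y"] yk(2) by auto
    thus "y \<in> H" using yk(1) by (simp add: ab)
  qed
  finally have "\<forall>\<^sub>F k in sequentially. prob (h k) < t" using H(2) by (rule order_tendstoD)
  then obtain k where k: "prob (h k) < t" using eventually_happens'[OF sequentially_bot] by blast
  have "x \<in> X" "dot n a x \<ge> b" using H(1) by (auto simp: ab)
  hence "x \<in> h k" by (auto simp: h_def half_def intro: less_le_trans[of _ b])
  thus ?thesis using k ab assms(2) unfolding shallow_def h_def by blast
qed

text \<open>The complement of \<open>shallow t\<close> in \<open>X\<close> is an intersection of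
  closed half-spaces.\<close>

lemma deep_convex:
  assumes "x \<in> X - shallow t" "y \<in> X - shallow t" "0 \<le> l" "l \<le> 1"
  shows "comb l x y \<in> X - shallow t"
proof -
  have X: "comb l x y \<in> X" using assms by (intro comb_in_topspace) auto
  have "comb l x y \<notin> half a b" if ab: "a \<in> X" "a \<noteq> (\<lambda>_. 0)" "prob (half a b) < t" for a b
  proof -
    have "dot n a x \<le> b" "dot n a y \<le> b"
      using assms(1,2) ab unfolding shallow_def half_def by (auto simp: not_less[symmetric])
    hence "dot n a (comb l x y) \<le> b"
      unfolding dot_comb using assms(3,4) by (intro convex_bound_le) auto
    thus ?thesis by (simp add: half_def)
  qed
  with X show ?thesis by (auto simp: shallow_def)
qed

text \<open>The complement of the image of the deep region under the homothety with centre
  \<open>z\<close> and ratio \<open>1 / u\<close>.\<close>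

definition outside :: "real \<Rightarrow> (nat \<Rightarrow> real) \<Rightarrow> real \<Rightarrow> (nat \<Rightarrow> real) set" where
  "outside t z u = {x \<in> X. comb u x z \<in> shallow t}"

lemma outside_sets:
  assumes "z \<in> X"
  shows "outside t z u \<in> sets \<mu>"
proof -
  obtain U where U: "open U" "shallow t = X \<inter> U" by (rule shallow_open)
  have "continuous_on UNIV (\<lambda>x. comb u x z)"
    unfolding comb_def
    by (intro continuous_on_coordinatewise_then_product continuous_on_add continuous_on_mult
        continuous_on_const continuous_on_coordinate)
  hence "open {x. comb u x z \<in> U}" using U(1) by (rule open_Collect_continuous_mem)
  moreover have "outside t z u = X \<inter> {x. comb u x z \<in> U}"
    using assms by (auto simp: outside_def U(2) intro: comb_in_topspace)
  ultimately show ?thesis using open_sets by simp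
qed

lemma shallow_sets: "shallow t \<in> sets \<mu>"
  using shallow_open[of t] open_sets by metis

text \<open>The deep region is star-shaped about the deep point \<open>z\<close>, and
  \<open>comb v x z\<close> lies on the segment from \<open>z\<close> to
  \<open>comb u x z\<close>.\<close>

lemma outside_mono:
  assumes "z \<in> X - shallow t" "0 < v" "v \<le> u"
  shows "outside t z v \<subseteq> outside t z u"
proof
  fix x assume x: "x \<in> outside t z v"
  show "x \<in> outside t z u"
  proof (rule ccontr)
    assume "x \<notin> outside t z u"
    hence "comb u x z \<in> X - shallow t"
      using x assms by (auto simp: outside_def intro: comb_in_topspace)
    hence "comb (v / u) (comb u x z) z \<in> X - shallow t"
      by (rule deep_convex) (use assms in auto)
    moreover have "comb (v / u) (comb u x z) z = comb v x z"
      using assms by (auto simp: comb_def fun_eq_iff field_simps)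
    ultimately show False using x by (simp add: outside_def)
  qed
qed

text \<open>If the dilate of the moved point were deep, then \<open>x\<close> would be a convex
  combination of it and a point \<open>q'\<close> of the deep cube, hence deep. The last numerical
  hypothesis says exactly that \<open>\<theta> \<ge> u * l * \<epsilon>\<close>, which keeps
  \<open>q'\<close> in that cube.\<close>

lemma comb_in_outside:
  assumes x: "x \<in> shallow t" and q: "q \<in> cube n z (\<epsilon> * \<rho>)"
    and deep: "cube n z \<rho> \<subseteq> X - shallow t" and z: "z \<in> X"
    and pos: "0 < l" "l < 1" "0 < \<epsilon>" "0 < u" "\<rho> > 0" "u * (1 - l - l * \<epsilon>) \<ge> 1"
  shows "comb (1 - l) x q \<in> outside t z u"
proof (rule ccontr)
  let ?w = "comb (1 - l) x q"
  have X: "x \<in> X" "q \<in> X" using x q by (auto simp: shallow_def cube_def)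
  hence w: "?w \<in> X" by (rule comb_in_topspace)
  assume "?w \<notin> outside t z u"
  hence uw: "comb u ?w z \<in> X - shallow t"
    using w z by (auto simp: outside_def intro: comb_in_topspace)
  define \<theta> where "\<theta> = u * (1 - l) - 1"
  have \<theta>: "\<theta> \<ge> u * l * \<epsilon>" using pos(6) by (simp add: \<theta>_def algebra_simps)
  have "u * l * \<epsilon> > 0" using pos by simp
  with \<theta> have \<theta>_pos: "\<theta> > 0" by linarith
  \<comment> \<open>The reflection of \<open>q\<close> through \<open>z\<close>, scaled so that
    weight \<open>\<theta>\<close> on \<open>q'\<close> cancels the contribution
    \<open>u * l * (q i - z i)\<close>.\<close>
  define q' where "q' = (\<lambda>i. z i - u * l / \<theta> * (q i - z i))"
  have "\<bar>q' i - z i\<bar> \<le> \<rho>" if "i < n" for i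
  proof -
    have "\<bar>q' i - z i\<bar> = u * l / \<theta> * \<bar>q i - z i\<bar>"
      using pos \<theta>_pos by (simp add: q'_def abs_mult)
    also have "\<dots> \<le> u * l / \<theta> * (\<epsilon> * \<rho>)"
      using q that pos \<theta>_pos by (intro mult_left_mono) (auto simp: cube_def)
    also have "\<dots> = (u * l * \<epsilon>) / \<theta> * \<rho>" by simp
    also have "\<dots> \<le> 1 * \<rho>" using \<theta> \<theta>_pos pos by (intro mult_right_mono) auto
    finally show ?thesis by simp
  qed
  moreover have "q' \<in> X" using X z by (simp add: q'_def topspace_Euclidean_space)
  ultimately have "q' \<in> X - shallow t" using deep by (auto simp: cube_def)
  with uw have "comb (1 / (1 + \<theta>)) (comb u ?w z) q' \<in> X - shallow t"
    by (rule deep_convex) (use \<theta>_pos in auto)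
  also have "comb (1 / (1 + \<theta>)) (comb u ?w z) q' = x"
  proof
    fix i
    have "1 - 1 / (1 + \<theta>) = \<theta> / (1 + \<theta>)" using \<theta>_pos by (simp add: field_simps)
    hence "comb (1 / (1 + \<theta>)) (comb u ?w z) q' i = (comb u ?w z i + \<theta> * q' i) / (1 + \<theta>)"
      by (simp add: comb_def[of "1 / (1 + \<theta>)"] add_divide_distrib)
    also have "\<theta> * q' i = \<theta> * z i - u * l * (q i - z i)"
      using \<theta>_pos by (simp add: q'_def right_diff_distrib)
    also have "comb u ?w z i + (\<theta> * z i - u * l * (q i - z i)) = (1 + \<theta>) * x i"
      by (simp add: comb_def \<theta>_def algebra_simps)
    finally show "comb (1 / (1 + \<theta>)) (comb u ?w z) q' i = x i" using \<theta>_pos by simp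
  qed
  finally show False using x by simp
qed

text \<open>The counterpart of \<open>comb_in_outside\<close>: the dilate \<open>comb v ?w z\<close>
  is a convex combination of three deep points, namely the contraction \<open>?P\<close> of
  \<open>x\<close>, the magnification \<open>Q\<close> of \<open>q\<close> by
  \<open>1 / \<epsilon>\<close> about \<open>z\<close>, and \<open>z\<close> itself, with weights
  \<open>\<alpha>\<close>, \<open>\<beta>\<close> and the rest. The last numerical hypothesis is
  \<open>\<alpha> + \<beta> \<le> 1\<close>.\<close>

lemma comb_not_in_outside:
  assumes x: "x \<in> X" "x \<notin> outside t z (1 - \<epsilon>)" and q: "q \<in> cube n z (\<epsilon> * \<rho>)"
    and deep: "cube n z \<rho> \<subseteq> X - shallow t" and z: "z \<in> X"
    and pos: "0 < l" "l < 1" "0 < \<epsilon>" "\<epsilon> < 1" "0 < v" "\<rho> > 0"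
      "v * ((1 - l) / (1 - \<epsilon>) + l * \<epsilon>) \<le> 1"
  shows "comb (1 - l) x q \<notin> outside t z v"
proof -
  let ?w = "comb (1 - l) x q" and ?P = "comb (1 - \<epsilon>) x z"
  have P: "?P \<in> X - shallow t"
    using x z by (auto simp: outside_def intro: comb_in_topspace)
  define Q where "Q = (\<lambda>i. z i + (q i - z i) / \<epsilon>)"
  have "\<bar>Q i - z i\<bar> \<le> \<rho>" if "i < n" for i
    using q pos(3) that by (simp add: cube_def Q_def abs_divide field_simps)
  moreover have "Q \<in> X" using q z by (simp add: Q_def topspace_Euclidean_space cube_def)
  ultimately have Q: "Q \<in> X - shallow t" using deep by (auto simp: cube_def)
  define \<alpha> \<beta> where "\<alpha> = v * ((1 - l) / (1 - \<epsilon>))" and "\<beta> = v * (l * \<epsilon>)"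
  have ab: "\<alpha> > 0" "\<beta> > 0" using pos by (auto simp: \<alpha>_def \<beta>_def)
  have ab1: "\<alpha> + \<beta> \<le> 1" using pos(7) by (simp add: \<alpha>_def \<beta>_def distrib_left)
  have z_deep: "z \<in> X - shallow t" using deep z pos by (auto simp: cube_def)
  have "comb (\<alpha> / (\<alpha> + \<beta>)) ?P Q \<in> X - shallow t"
    using P Q by (rule deep_convex) (use ab in auto)
  hence "comb (\<alpha> + \<beta>) (comb (\<alpha> / (\<alpha> + \<beta>)) ?P Q) z \<in> X - shallow t"
    using z_deep by (rule deep_convex) (use ab ab1 in auto)
  also have "comb (\<alpha> + \<beta>) (comb (\<alpha> / (\<alpha> + \<beta>)) ?P Q) z = comb v ?w z"
  proof
    fix i
    have "1 - \<alpha> / (\<alpha> + \<beta>) = \<beta> / (\<alpha> + \<beta>)" using ab by (simp add: field_simps)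
    hence "(\<alpha> + \<beta>) * comb (\<alpha> / (\<alpha> + \<beta>)) ?P Q i = \<alpha> * ?P i + \<beta> * Q i"
      using ab by (simp add: comb_def[of "\<alpha> / (\<alpha> + \<beta>)"] distrib_left)
    hence "comb (\<alpha> + \<beta>) (comb (\<alpha> / (\<alpha> + \<beta>)) ?P Q) z i = z i + \<alpha> * (?P i - z i) + \<beta> * (Q i - z i)"
      by (simp add: comb_def[of "\<alpha> + \<beta>"] algebra_simps)
    also have "?P i - z i = (1 - \<epsilon>) * (x i - z i)" by (simp add: comb_def algebra_simps)
    also have "\<alpha> * ((1 - \<epsilon>) * (x i - z i)) = v * (1 - l) * (x i - z i)"
      using pos by (simp add: \<alpha>_def)
    also have "\<beta> * (Q i - z i) = v * l * (q i - z i)"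
      using pos by (simp add: \<beta>_def Q_def)
    also have "z i + v * (1 - l) * (x i - z i) + v * l * (q i - z i) = comb v ?w z i"
      by (simp add: comb_def algebra_simps)
    finally show "comb (\<alpha> + \<beta>) (comb (\<alpha> / (\<alpha> + \<beta>)) ?P Q) z i = comb v ?w z i" .
  qed
  finally show ?thesis by (simp add: outside_def)
qed

section \<open>The measure of the thin shell\<close>

lemma powr_ge_self:
  fixes a l :: real
  assumes "0 \<le> a" "a \<le> 1" "l \<le> 1"
  shows "a \<le> a powr l"
proof (cases "a = 0")
  case False
  thus ?thesis using powr_mono'[of l 1 a] assms by simp
qed simp

text \<open>The disjoint shells are \<open>G (Suc j) - G j\<close>. Each contains a combination of
  the original shell \<open>S\<close> with the small cube around \<open>z\<close>, so each has
  measure at least \<open>c * sqrt \<epsilon>\<close> times that of \<open>S\<close>, while their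
  total is at most 1.\<close>

lemma shell_bound:
  assumes n: "n \<ge> 1" and z: "z \<in> X" and \<rho>: "\<rho> > 0"
    and deep: "cube n z \<rho> \<subseteq> X - shallow t"
    and \<epsilon>: "0 < \<epsilon>" "\<epsilon> \<le> 1 / (8 * real n)"
    and c: "0 < c" "c \<le> 1" "c * \<epsilon> ^ n \<le> prob (cube n z (\<epsilon> * \<rho>))"
  shows "prob (shallow t - outside t z (1 - \<epsilon>)) \<le> 16 * real n / c * sqrt \<epsilon>"
proof -
  define S where "S = shallow t - outside t z (1 - \<epsilon>)"
  have S_sets: "S \<in> sets \<mu>" unfolding S_def using outside_sets[OF z] shallow_sets by auto
  have z_deep: "z \<in> X - shallow t" using deep z \<rho> by (auto simp: cube_def)
  have n\<epsilon>: "8 * real n * \<epsilon> \<le> 1" using \<epsilon> n by (simp add: field_simps)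
  have "8 * \<epsilon> \<le> 8 * real n * \<epsilon>" using n \<epsilon> by simp
  hence \<epsilon>8: "\<epsilon> \<le> 1 / 8" using n\<epsilon> by linarith
  \<comment> \<open>The largest range of \<open>j\<close> for which the weight
    \<open>4 * j * \<epsilon>\<close> stays at most \<open>1 / (2 * n)\<close>; beyond this the
    factor \<open>(\<epsilon> ^ n) powr l\<close> could drop below
    \<open>sqrt \<epsilon>\<close>.\<close>
  define J where "J = nat \<lfloor>1 / (8 * real n * \<epsilon>)\<rfloor>"
  have inv: "1 / (8 * real n * \<epsilon>) \<ge> 1" using n\<epsilon> n \<epsilon> by simp
  have J_real: "real J = real_of_int \<lfloor>1 / (8 * real n * \<epsilon>)\<rfloor>"
  proof -
    have "0 \<le> \<lfloor>1 / (8 * real n * \<epsilon>)\<rfloor>" using inv by linarith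
    thus ?thesis unfolding J_def by simp
  qed
  have J_up: "real J \<le> 1 / (8 * real n * \<epsilon>)" unfolding J_real by simp
  have J_low: "real J \<ge> 1 / (16 * real n * \<epsilon>)"
  proof -
    have "real J > 1 / (8 * real n * \<epsilon>) - 1" unfolding J_real by linarith
    moreover have "real J \<ge> 1" unfolding J_real using inv by simp
    moreover have "1 / (16 * real n * \<epsilon>) = 1 / (8 * real n * \<epsilon>) / 2" by simp
    ultimately show ?thesis by linarith
  qed
  have lam: "4 * real j * \<epsilon> \<le> 1 / (2 * real n)" if "j \<le> J" for j
  proof -
    have "real j \<le> 1 / (8 * real n * \<epsilon>)" using that J_up by linarith
    hence "4 * real j * \<epsilon> \<le> 4 * (1 / (8 * real n * \<epsilon>)) * \<epsilon>"
      using \<epsilon> by (intro mult_right_mono mult_left_mono) auto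
    also have "4 * (1 / (8 * real n * \<epsilon>)) * \<epsilon> = 1 / (2 * real n)"
      using \<epsilon> n by (simp add: field_simps)
    finally show ?thesis .
  qed
  have half_n: "1 / (2 * real n) \<le> 1 / 2" using n by simp
  \<comment> \<open>\<open>d j\<close> is the dilation ratio of the deep region complementary to
    \<open>G j\<close>. With \<open>l\<close> the weight of step \<open>Suc j\<close>, the moved
    shell fits between the ratios \<open>1 - l - \<epsilon>\<close> and
    \<open>1 - l + 3 * \<epsilon>\<close>; the step width \<open>4 * \<epsilon>\<close> makes these
    ranges adjacent.\<close>
  define d where "d = (\<lambda>j::nat. 1 - (4 * real j + 1) * \<epsilon>)"
  have d_pos: "d j > 0" if "j \<le> J" for j
    using lam[OF that] half_n \<epsilon>8 unfolding d_def distrib_right by linarith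
  define G where "G = (\<lambda>j. outside t z (1 / d j))"
  have G_sets: "G j \<in> sets \<mu>" for j unfolding G_def by (rule outside_sets[OF z])
  have d_Suc: "d (Suc j) \<le> d j" for j using \<epsilon> by (simp add: d_def algebra_simps)
  have step: "prob S * (c * sqrt \<epsilon>) \<le> prob (G (Suc j)) - prob (G j)" if j: "j < J" for j
  proof -
    define l where "l = 4 * real (Suc j) * \<epsilon>"
    have l: "0 < l" "l \<le> 1 / (2 * real n)" using lam[of "Suc j"] j \<epsilon> by (auto simp: l_def)
    have l1: "l < 1" using l half_n by linarith
    have dl: "d (Suc j) = 1 - l - \<epsilon>" "d j = 1 - l + 3 * \<epsilon>"
      by (simp_all add: d_def l_def algebra_simps)
    have d: "d j > 0" "d (Suc j) > 0" using d_pos j by simp_all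
    have "G j \<subseteq> G (Suc j)"
      unfolding G_def using d d_Suc[of j] z_deep by (intro outside_mono) (auto intro: frac_le)
    hence "prob (G (Suc j)) - prob (G j) = prob (G (Suc j) - G j)"
      using G_sets by (intro finite_measure_Diff[symmetric])
    also have "\<dots> \<ge> prob S powr (1 - l) * prob (cube n z (\<epsilon> * \<rho>)) powr (1 - (1 - l))"
    proof (rule prob_comb_ge)
      fix x q assume x: "x \<in> S" and q: "q \<in> cube n z (\<epsilon> * \<rho>)"
      have "l * \<epsilon> \<le> \<epsilon>" using l1 \<epsilon> by simp
      hence "1 / d (Suc j) * (1 - l - l * \<epsilon>) \<ge> 1"
        using d(2) dl(1) by (simp add: field_simps)
      hence "comb (1 - l) x q \<in> G (Suc j)"
        unfolding G_def using x q deep z l l1 \<epsilon> d \<rho>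
        by (intro comb_in_outside[where \<epsilon> = \<epsilon> and \<rho> = \<rho>]) (auto simp: S_def)
      moreover have "comb (1 - l) x q \<notin> G j"
      proof -
        have "1 / (1 - \<epsilon>) \<le> 1 + 2 * \<epsilon>"
        proof -
          have "2 * \<epsilon> * \<epsilon> \<le> \<epsilon>" using \<epsilon>(1) \<epsilon>8 by simp
          hence "1 \<le> (1 + 2 * \<epsilon>) * (1 - \<epsilon>)" by (simp add: algebra_simps)
          thus ?thesis using \<epsilon>8 by (simp add: pos_divide_le_eq)
        qed
        hence "(1 - l) * (1 / (1 - \<epsilon>)) \<le> (1 - l) * (1 + 2 * \<epsilon>)"
          using l1 by (intro mult_left_mono) auto
        moreover have "(1 - l) * (1 + 2 * \<epsilon>) = 1 - l + 2 * \<epsilon> - 2 * (l * \<epsilon>)" by (simp add: algebra_simps)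
        moreover have "l * \<epsilon> > 0" using l \<epsilon> by simp
        ultimately have "(1 - l) / (1 - \<epsilon>) + l * \<epsilon> \<le> d j"
          using \<epsilon>(1) unfolding dl by simp
        hence "1 / d j * ((1 - l) / (1 - \<epsilon>) + l * \<epsilon>) \<le> 1"
          using d(1) by (simp add: pos_divide_le_eq)
        thus ?thesis
          unfolding G_def using x q deep z l l1 \<epsilon> \<epsilon>8 d \<rho>
          by (intro comb_not_in_outside[where \<epsilon> = \<epsilon> and \<rho> = \<rho>]) (auto simp: S_def shallow_def)
      qed
      ultimately show "comb (1 - l) x q \<in> G (Suc j) - G j" by simp
    qed (use S_sets G_sets l l1 in auto)
    finally have "prob S powr (1 - l) * prob (cube n z (\<epsilon> * \<rho>)) powr l \<le> prob (G (Suc j)) - prob (G j)"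
      by simp
    moreover have "prob S * (c * sqrt \<epsilon>) \<le> prob S powr (1 - l) * prob (cube n z (\<epsilon> * \<rho>)) powr l"
    proof (intro mult_mono)
      show "prob S \<le> prob S powr (1 - l)" using l by (intro powr_ge_self) auto
      have c\<epsilon>: "0 < c * \<epsilon> ^ n" using c \<epsilon> by simp
      have c\<epsilon>1: "c * \<epsilon> ^ n \<le> 1" using c(3) prob_le_1 order_trans by blast
      have "sqrt \<epsilon> = (\<epsilon> ^ n) powr (1 / (2 * real n))"
        using \<epsilon> n by (simp add: powr_powr powr_half_sqrt flip: powr_realpow)
      moreover have "c \<le> c powr (1 / (2 * real n))" using c n by (intro powr_ge_self) auto
      ultimately have "c * sqrt \<epsilon> \<le> c powr (1 / (2 * real n)) * (\<epsilon> ^ n) powr (1 / (2 * real n))"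
        using \<epsilon> by (simp add: mult_right_mono)
      also have "\<dots> = (c * \<epsilon> ^ n) powr (1 / (2 * real n))"
        using c \<epsilon> by (simp add: powr_mult)
      also have "\<dots> \<le> (c * \<epsilon> ^ n) powr l"
        using l c\<epsilon> c\<epsilon>1 by (intro powr_mono') auto
      also have "\<dots> \<le> prob (cube n z (\<epsilon> * \<rho>)) powr l"
        using c(3) c\<epsilon> l by (intro powr_mono2) auto
      finally show "c * sqrt \<epsilon> \<le> prob (cube n z (\<epsilon> * \<rho>)) powr l" .
    qed (use c \<epsilon> in auto)
    ultimately show ?thesis by linarith
  qed
  have "real J * (prob S * (c * sqrt \<epsilon>)) = (\<Sum>j<J. prob S * (c * sqrt \<epsilon>))" by simp
  also have "\<dots> \<le> (\<Sum>j<J. prob (G (Suc j)) - prob (G j))" using step by (intro sum_mono) auto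
  also have "\<dots> = prob (G J) - prob (G 0)" by (rule sum_lessThan_telescope)
  also have "\<dots> \<le> 1" using prob_le_1[of "G J"] measure_nonneg[of \<mu> "G 0"] by linarith
  finally have "real J * (prob S * (c * sqrt \<epsilon>)) \<le> 1" .
  moreover have "1 / (16 * real n * \<epsilon>) * (prob S * (c * sqrt \<epsilon>)) \<le> real J * (prob S * (c * sqrt \<epsilon>))"
    using J_low c \<epsilon> by (intro mult_right_mono) auto
  ultimately have "1 / (16 * real n * \<epsilon>) * (prob S * (c * sqrt \<epsilon>)) \<le> 1" by linarith
  hence "prob S * c * sqrt \<epsilon> \<le> 16 * real n * \<epsilon>"
    using n \<epsilon> by (simp add: pos_divide_le_eq)
  also have "16 * real n * \<epsilon> = (16 * real n * sqrt \<epsilon>) * sqrt \<epsilon>" using \<epsilon> by simp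
  finally have "prob S * c \<le> 16 * real n * sqrt \<epsilon>"
    by (rule mult_right_le_imp_le) (use \<epsilon> in simp)
  thus ?thesis unfolding S_def[symmetric] using c by (simp add: field_simps)
qed

text \<open>The half-space has room to spare: in units of \<open>\<epsilon> * k * norm1 n a\<close>,
  mixing in \<open>B\<close> with weight \<open>\<epsilon>\<close> gains 3/4 (1/4 being lost by
  centring at \<open>z\<close> instead of \<open>z0\<close>), while a cube of radius
  \<open>\<eta>\<close> around \<open>y\<close> loses at most 1/2. So the cube carries measure at
  most \<open>t / \<delta>\<close>, and the pigeonhole bound passes this on to the whole
  set.\<close>

lemma outside_cube_bound:
  assumes z0: "z0 \<in> X" and k: "k > 0" and \<delta>: "0 < \<delta>" "\<delta> \<le> 1"
    and B: "\<And>a. a \<in> X \<Longrightarrow> \<exists>B\<in>sets \<mu>. prob B \<ge> \<delta> \<and> (\<forall>x\<in>B. dot n a x \<ge> dot n a z0 + k * norm1 n a)"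
    and z: "z \<in> cube n z0 (k / 4)" and \<epsilon>: "0 < \<epsilon>" "\<epsilon> < 1" "\<epsilon> * k / 2 \<le> R" and t: "t > 0"
  shows "prob (outside t z (1 - \<epsilon>) \<inter> cube n z0 R) \<le> t / \<delta> * (10 * R / (\<epsilon> * k)) ^ n"
proof -
  define A0 where "A0 = outside t z (1 - \<epsilon>) \<inter> cube n z0 R"
  define \<eta> where "\<eta> = \<epsilon> * k / 2"
  have \<eta>: "0 < \<eta>" "\<eta> \<le> R" using \<epsilon> k by (auto simp: \<eta>_def)
  have zX: "z \<in> X" using z by (simp add: cube_def)
  have A0_sets: "A0 \<in> sets \<mu>" unfolding A0_def using outside_sets[OF zX] by auto
  show ?thesis
  proof (cases "A0 = {}")
    case True
    thus ?thesis unfolding A0_def[symmetric] using t \<delta> \<epsilon> \<eta> k by simp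
  next
    case False
    obtain y where y: "y \<in> A0" "prob (A0 \<inter> cube n y \<eta>) \<ge> prob A0 * (\<eta> / (5 * R)) ^ n"
      using cube_pigeonhole[OF A0_sets _ False \<eta>, of z0] by (auto simp: A0_def)
    have yX: "y \<in> X" using y by (auto simp: A0_def cube_def)
    have "comb (1 - \<epsilon>) y z \<in> shallow t" using y by (auto simp: A0_def outside_def)
    then obtain a b where ab: "a \<in> X" "prob (half a b) < t" "dot n a (comb (1 - \<epsilon>) y z) > b"
      by (auto simp: shallow_def half_def)
    obtain B where B: "B \<in> sets \<mu>" "prob B \<ge> \<delta>" "\<And>x. x \<in> B \<Longrightarrow> dot n a x \<ge> dot n a z0 + k * norm1 n a"
      using B[OF ab(1)] by blast
    let ?A = "A0 \<inter> cube n y \<eta>"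
    have "prob ?A powr (1 - \<epsilon>) * prob B powr (1 - (1 - \<epsilon>)) \<le> prob (half a b)"
    proof (rule prob_comb_ge)
      fix x w assume x: "x \<in> ?A" and w: "w \<in> B"
      have eps: "1 - (1 - \<epsilon>) = \<epsilon>" by simp
      have "\<bar>dot n a x - dot n a y\<bar> \<le> \<eta> * norm1 n a"
        using x by (intro abs_dot_diff_le) (auto simp: cube_def)
      hence 1: "dot n a x \<ge> dot n a y - \<eta> * norm1 n a" by linarith
      have "\<bar>dot n a z - dot n a z0\<bar> \<le> (k / 4) * norm1 n a"
        using z by (intro abs_dot_diff_le) (auto simp: cube_def)
      moreover have "(k / 4) * norm1 n a = k * norm1 n a / 4" by simp
      moreover have "(3 / 4 * k) * norm1 n a = 3 / 4 * (k * norm1 n a)" by simp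
      ultimately have "dot n a w \<ge> dot n a z + (3 / 4 * k) * norm1 n a"
        using B(3)[OF w] by linarith
      hence "\<epsilon> * (dot n a z + (3 / 4 * k) * norm1 n a) \<le> \<epsilon> * dot n a w"
        using \<epsilon> by (intro mult_left_mono) auto
      moreover have "(1 - \<epsilon>) * (dot n a y - \<eta> * norm1 n a) \<le> (1 - \<epsilon>) * dot n a x"
        using 1 \<epsilon> by (intro mult_left_mono) auto
      moreover have "(1 - \<epsilon>) * (\<eta> * norm1 n a) \<le> 1 * (\<eta> * norm1 n a)"
        using \<epsilon> \<eta> norm1_nonneg[of n a] by (intro mult_right_mono) auto
      moreover have "\<eta> * norm1 n a = (\<epsilon> * k * norm1 n a) / 2" by (simp add: \<eta>_def)
      moreover have "\<epsilon> * k * norm1 n a \<ge> 0" using \<epsilon> k norm1_nonneg[of n a] by simp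
      moreover have "\<epsilon> * (dot n a z + (3 / 4 * k) * norm1 n a) = \<epsilon> * dot n a z + 3 / 4 * (\<epsilon> * k * norm1 n a)"
        by (simp add: algebra_simps)
      moreover have "(1 - \<epsilon>) * (dot n a y - \<eta> * norm1 n a) = (1 - \<epsilon>) * dot n a y - (1 - \<epsilon>) * (\<eta> * norm1 n a)"
        by (simp add: algebra_simps)
      ultimately have "dot n a (comb (1 - \<epsilon>) x w) \<ge> dot n a (comb (1 - \<epsilon>) y z)"
        unfolding dot_comb eps by linarith
      moreover have "comb (1 - \<epsilon>) x w \<in> X"
        using x w B(1) by (intro comb_in_topspace) (auto simp: A0_def cube_def sets_mu)
      ultimately show "comb (1 - \<epsilon>) x w \<in> half a b" using ab(3) by (simp add: half_def)
    qed (use \<epsilon> A0_sets B half_sets in auto)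
    moreover have "prob ?A * \<delta> \<le> prob ?A powr (1 - \<epsilon>) * prob B powr (1 - (1 - \<epsilon>))"
    proof (intro mult_mono)
      show "prob ?A \<le> prob ?A powr (1 - \<epsilon>)" using \<epsilon> by (intro powr_ge_self) auto
      have "prob B \<le> prob B powr (1 - (1 - \<epsilon>))" using \<epsilon> by (intro powr_ge_self) auto
      thus "\<delta> \<le> prob B powr (1 - (1 - \<epsilon>))" using B(2) by linarith
    qed (use \<delta> in auto)
    ultimately have "prob ?A * \<delta> \<le> t" using ab(2) by linarith
    moreover have "prob A0 * (\<eta> / (5 * R)) ^ n * \<delta> \<le> prob ?A * \<delta>"
      using y(2) \<delta> by (intro mult_right_mono) auto
    ultimately have "prob A0 * (\<eta> / (5 * R)) ^ n * \<delta> \<le> t" by linarith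
    hence le: "prob A0 * (\<eta> / (5 * R)) ^ n \<le> t / \<delta>" using \<delta> by (simp add: pos_le_divide_eq)
    have "10 * R / (\<epsilon> * k) = 5 * R / \<eta>" using \<epsilon> k by (simp add: \<eta>_def)
    hence "(\<eta> / (5 * R)) * (10 * R / (\<epsilon> * k)) = 1" using \<eta> by simp
    hence "prob A0 = prob A0 * (\<eta> / (5 * R)) ^ n * (10 * R / (\<epsilon> * k)) ^ n"
      by (simp only: mult.assoc flip: power_mult_distrib) simp
    also have "\<dots> \<le> t / \<delta> * (10 * R / (\<epsilon> * k)) ^ n"
      using le \<eta> \<epsilon> k by (intro mult_right_mono) auto
    finally show ?thesis unfolding A0_def .
  qed
qed

text \<open>The three parts are balanced so that each is of order \<open>sqrt \<epsilon>\<close>,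
  which is \<open>t powr (1 / (4 * n))\<close>.\<close>

lemma prob_shallow_bound:
  assumes n: "n \<ge> 1"
  obtains C where "C > 0" "\<And>t. t > 0 \<Longrightarrow> prob (shallow t) \<le> C * t powr (1 / (4 * real n))"
proof -
  obtain z0 k \<delta> where cp: "z0 \<in> supp" "k > 0" "0 < \<delta>" "\<delta> \<le> 1"
    and B: "\<And>a. a \<in> X \<Longrightarrow> \<exists>B\<in>sets \<mu>. prob B \<ge> \<delta> \<and> (\<forall>x\<in>B. dot n a x \<ge> dot n a z0 + k * norm1 n a)"
    by (rule central_point[OF n]) blast
  have z0: "z0 \<in> X" using cp by (simp add: supp_def)
  obtain C2 where C2: "C2 > 0" "\<And>R. R > 0 \<Longrightarrow> prob (X - cube n z0 R) \<le> C2 / R"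
    by (rule tail_bound[OF z0]) blast
  define c where "c = prob (cube n z0 (k / 4)) / 5 ^ n"
  have "prob (cube n z0 (k / 4)) > 0" using cp by (simp add: supp_def)
  moreover have "(1::real) \<le> 5 ^ n" by (rule one_le_power) simp
  ultimately have c: "c > 0" "c \<le> 1"
    using prob_le_1[of "cube n z0 (k / 4)"] by (auto simp: c_def pos_divide_le_eq intro: order_trans)
  \<comment> \<open>The three entries serve, in this order, the shell estimate, the condition
    \<open>\<epsilon> * k / 2 \<le> R\<close>, and \<open>t \<le> \<delta>\<close>.\<close>
  define e0 where "e0 = Min {1 / (8 * real n), 1 / k, \<delta> powr (1 / (2 * real n))}"
  have e0: "e0 > 0" "e0 \<le> 1 / (8 * real n)" "e0 \<le> 1 / k" "e0 \<le> \<delta> powr (1 / (2 * real n))"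
    using n cp by (auto simp: e0_def)
  define C1 where "C1 = 16 * real n / c + (10 / k) ^ n / \<delta> + C2"
  have C1: "C1 > 0" using c cp C2 by (auto simp: C1_def intro!: add_nonneg_pos add_nonneg_nonneg)
  have main: "prob (shallow t) \<le> C1 * sqrt \<epsilon>" if t: "t > 0" and \<epsilon>_def: "\<epsilon> = t powr (1 / (2 * real n))" and le: "\<epsilon> \<le> e0" for t \<epsilon>
  proof -
    have \<epsilon>: "\<epsilon> > 0" using t by (simp add: \<epsilon>_def)
    have \<epsilon>n: "\<epsilon> \<le> 1 / (8 * real n)" using le e0 by simp
    also have "\<dots> \<le> 1 / 8" using n by (intro divide_left_mono) auto
    finally have \<epsilon>8: "\<epsilon> \<le> 1 / 8" .
    have t_eq: "t = \<epsilon> ^ (2 * n)"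
    proof -
      have "\<epsilon> ^ (2 * n) = \<epsilon> powr (real (2 * n))" using \<epsilon> by (rule powr_realpow[symmetric])
      also have "\<dots> = t powr (1 / (2 * real n) * real (2 * n))" unfolding \<epsilon>_def powr_powr ..
      also have "\<dots> = t" using t n by simp
      finally show ?thesis ..
    qed
    have t_sq: "t = (\<epsilon>\<^sup>2) ^ n" unfolding t_eq by (rule power_mult)
    have t\<delta>: "t \<le> \<delta>"
    proof (rule ccontr)
      assume "\<not> t \<le> \<delta>"
      hence "\<delta> powr (1 / (2 * real n)) < t powr (1 / (2 * real n))"
        using cp n by (intro powr_less_mono2) auto
      thus False using le e0(4) unfolding \<epsilon>_def by linarith
    qed
    define \<rho> where "\<rho> = k / 4"
    have \<rho>: "\<rho> > 0" using cp by (simp add: \<rho>_def)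
    \<comment> \<open>A half-space meeting this cube contains a translate through the far side of
      it, hence one of the sets \<open>B\<close>, of measure at least
      \<open>\<delta> \<ge> t\<close>.\<close>
    have deep0: "cube n z0 (k / 2) \<subseteq> X - shallow t"
    proof
      fix w assume w: "w \<in> cube n z0 (k / 2)"
      have "w \<notin> half a b" if a: "a \<in> X" and p: "prob (half a b) < t" for a b
      proof
        assume wh: "w \<in> half a b"
        obtain B where B: "B \<in> sets \<mu>" "prob B \<ge> \<delta>" "\<And>x. x \<in> B \<Longrightarrow> dot n a x \<ge> dot n a z0 + k * norm1 n a"
          using B[OF a] by blast
        have "\<bar>dot n a w - dot n a z0\<bar> \<le> (k / 2) * norm1 n a"
          using w by (intro abs_dot_diff_le) (auto simp: cube_def)
        moreover have "(k / 2) * norm1 n a \<le> k * norm1 n a"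
          using cp norm1_nonneg[of n a] by (intro mult_right_mono) auto
        moreover have "dot n a w > b" using wh by (simp add: half_def)
        ultimately have gt: "dot n a z0 + k * norm1 n a > b" by linarith
        have "B \<subseteq> half a b"
        proof
          fix x assume "x \<in> B"
          with B(1) B(3)[OF this] gt show "x \<in> half a b" by (auto simp: half_def sets_mu)
        qed
        hence "prob B \<le> prob (half a b)" using half_sets by (rule finite_measure_mono)
        thus False using B(2) p t\<delta> by linarith
      qed
      thus "w \<in> X - shallow t" using w by (auto simp: shallow_def cube_def)
    qed
    have "z0 \<in> cube n z0 (k / 4)" using z0 cp by (simp add: cube_def)
    hence ne: "cube n z0 (k / 4) \<noteq> {}" by blast
    have "0 < \<epsilon> * \<rho>" "\<epsilon> * \<rho> \<le> k / 4" using \<epsilon> \<epsilon>8 \<rho> by (simp_all add: \<rho>_def)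
    \<comment> \<open>Pigeonhole inside the fixed cube supplies a centre whose small cube has
      measure of order \<open>\<epsilon> ^ n\<close>; for \<open>z0\<close> itself no such rate is
      known.\<close>
    then obtain z where z: "z \<in> cube n z0 (k / 4)"
      "prob (cube n z0 (k / 4) \<inter> cube n z (\<epsilon> * \<rho>)) \<ge> prob (cube n z0 (k / 4)) * (\<epsilon> * \<rho> / (5 * (k / 4))) ^ n"
      using cube_pigeonhole[OF cube_sets subset_refl ne] by blast
    have ratio: "\<epsilon> * \<rho> / (5 * (k / 4)) = \<epsilon> / 5" using cp by (simp add: \<rho>_def)
    have "c * \<epsilon> ^ n = prob (cube n z0 (k / 4)) * (\<epsilon> * \<rho> / (5 * (k / 4))) ^ n"
      unfolding ratio c_def by (simp add: power_divide)
    also have "\<dots> \<le> prob (cube n z0 (k / 4) \<inter> cube n z (\<epsilon> * \<rho>))" by (rule z(2))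
    also have "\<dots> \<le> prob (cube n z (\<epsilon> * \<rho>))" by (rule finite_measure_mono) auto
    finally have cz: "c * \<epsilon> ^ n \<le> prob (cube n z (\<epsilon> * \<rho>))" .
    have zX: "z \<in> X" using z by (simp add: cube_def)
    have deep: "cube n z \<rho> \<subseteq> X - shallow t"
    proof -
      have "cube n z \<rho> \<subseteq> cube n z0 (k / 2)"
      proof
        fix x assume x: "x \<in> cube n z \<rho>"
        have "\<bar>x i - z0 i\<bar> \<le> k / 2" if "i < n" for i
        proof -
          have "\<bar>x i - z i\<bar> \<le> k / 4" "\<bar>z i - z0 i\<bar> \<le> k / 4"
            using x z(1) that by (auto simp: cube_def \<rho>_def)
          thus ?thesis by linarith
        qed
        thus "x \<in> cube n z0 (k / 2)" using x by (simp add: cube_def)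
      qed
      thus ?thesis using deep0 by blast
    qed
    have shell: "prob (shallow t - outside t z (1 - \<epsilon>)) \<le> 16 * real n / c * sqrt \<epsilon>"
      by (rule shell_bound[OF n zX \<rho> deep \<epsilon> \<epsilon>n c cz])
    \<comment> \<open>With \<open>t = \<epsilon> ^ (2 * n)\<close>, this radius gives
      \<open>sqrt \<epsilon> ^ n\<close> for the middle part and \<open>sqrt \<epsilon>\<close> for
      the tail, up to constants.\<close>
    define R where "R = 1 / sqrt \<epsilon>"
    have "sqrt \<epsilon> \<le> 1" using \<epsilon> \<epsilon>8 by simp
    hence R: "R \<ge> 1" using \<epsilon> by (simp add: R_def)
    have "\<epsilon> \<le> 1 / k" using le e0(3) by linarith
    hence "\<epsilon> * k \<le> 1" using cp by (simp add: pos_le_divide_eq)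
    hence kR: "\<epsilon> * k / 2 \<le> R" using R by simp
    have "\<epsilon> < 1" using \<epsilon>8 by simp
    have "prob (outside t z (1 - \<epsilon>) \<inter> cube n z0 R) \<le> t / \<delta> * (10 * R / (\<epsilon> * k)) ^ n"
      by (rule outside_cube_bound[OF z0 cp(2-4) B z(1) \<epsilon> \<open>\<epsilon> < 1\<close> kR t])
    also have "\<dots> = (10 / k) ^ n / \<delta> * (\<epsilon>\<^sup>2 * (R / \<epsilon>)) ^ n"
      by (simp add: t_sq power_mult_distrib power_divide mult_ac)
    also have "\<epsilon>\<^sup>2 * (R / \<epsilon>) = sqrt \<epsilon>"
    proof -
      have "\<epsilon>\<^sup>2 * (R / \<epsilon>) = \<epsilon> * R" using \<epsilon> by (simp add: power2_eq_square)
      also have "\<dots> = sqrt \<epsilon>" using \<epsilon> by (simp add: R_def real_div_sqrt)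
      finally show ?thesis .
    qed
    also have "(10 / k) ^ n / \<delta> * sqrt \<epsilon> ^ n \<le> (10 / k) ^ n / \<delta> * sqrt \<epsilon>"
      using power_decreasing[of 1 n "sqrt \<epsilon>"] n \<epsilon> \<open>sqrt \<epsilon> \<le> 1\<close> cp by (intro mult_left_mono) auto
    finally have mid: "prob (outside t z (1 - \<epsilon>) \<inter> cube n z0 R) \<le> (10 / k) ^ n / \<delta> * sqrt \<epsilon>" .
    have tail: "prob (X - cube n z0 R) \<le> C2 * sqrt \<epsilon>" using C2(2)[of R] R \<epsilon> by (simp add: R_def)
    let ?S = "shallow t - outside t z (1 - \<epsilon>)" and ?M = "outside t z (1 - \<epsilon>) \<inter> cube n z0 R"
    have sets: "?S \<in> sets \<mu>" "?M \<in> sets \<mu>" "X - cube n z0 R \<in> sets \<mu>"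
      using outside_sets[OF zX] shallow_sets X_sets by auto
    have "prob (shallow t) \<le> prob (?S \<union> ?M \<union> (X - cube n z0 R))"
      using sets by (intro finite_measure_mono) (auto simp: shallow_def)
    also have "\<dots> \<le> prob (?S \<union> ?M) + prob (X - cube n z0 R)"
      using sets by (intro measure_Un_le) auto
    also have "prob (?S \<union> ?M) \<le> prob ?S + prob ?M"
      using sets by (intro measure_Un_le) auto
    finally show ?thesis using shell mid tail by (simp add: C1_def distrib_right)
  qed
  \<comment> \<open>The second entry covers \<open>\<epsilon> > e0\<close>, where the trivial bound
    1 suffices.\<close>
  define C where "C = max C1 (1 / sqrt e0)"
  have "prob (shallow t) \<le> C * t powr (1 / (4 * real n))" if t: "t > 0" for t
  proof -
    define \<epsilon> where "\<epsilon> = t powr (1 / (2 * real n))"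
    have "sqrt \<epsilon> = t powr (1 / (4 * real n))"
      using t by (simp add: \<epsilon>_def powr_powr flip: powr_half_sqrt)
    moreover have "prob (shallow t) \<le> C * sqrt \<epsilon>"
    proof (cases "\<epsilon> \<le> e0")
      case True
      have "prob (shallow t) \<le> C1 * sqrt \<epsilon>" by (rule main[OF t \<epsilon>_def True])
      also have "\<dots> \<le> C * sqrt \<epsilon>" using t by (intro mult_right_mono) (auto simp: C_def \<epsilon>_def)
      finally show ?thesis .
    next
      case False
      have "prob (shallow t) \<le> 1" by simp
      also have "1 = 1 / sqrt e0 * sqrt e0" using e0(1) by simp
      also have "\<dots> \<le> C * sqrt \<epsilon>"
        using False e0(1) C1 by (intro mult_mono) (auto simp: C_def)
      finally show ?thesis .
    qed
    ultimately show ?thesis by simp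
  qed
  moreover have "C > 0" using C1 by (simp add: C_def)
  ultimately show ?thesis using that by blast
qed

section \<open>Summation over dyadic depth levels\<close>

lemma depth_nonneg:
  assumes "n \<ge> 1" "x \<in> X"
  shows "halfspace_depth n \<mu> x \<ge> 0"
proof -
  define e :: "nat \<Rightarrow> real" where "e = (\<lambda>i. if i = 0 then 1 else 0)"
  have "e \<in> X" "e 0 \<noteq> 0" using assms(1) by (simp_all add: e_def topspace_Euclidean_space)
  hence "e \<in> X" "e \<noteq> (\<lambda>_. 0)" by metis+
  hence "{y \<in> X. dot n e y \<ge> dot n e x} \<in> {H \<in> closed_halfspaces n. x \<in> H}"
    using assms(2) by (auto simp: closed_halfspaces_def)
  thus ?thesis unfolding halfspace_depth_def by (intro cINF_greatest) auto
qed

text \<open>If the depth lies in \<open>[(1/2) ^ Suc k, (1/2) ^ k)\<close>, the \<open>k\<close>-th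
  term alone suffices; if it is 0, every term is at least 1 and the series diverges; the summand 1
  covers depth at least 1. The majorant is measurable, so no measurability of the depth function has
  to be shown.\<close>

lemma depth_powr_le_sum:
  assumes n: "n \<ge> 1" and x: "x \<in> X" and p: "p > 0"
  shows "1 / ennreal (halfspace_depth n \<mu> x powr p)
    \<le> 1 + (\<Sum>k. ennreal (2 powr (p * real (Suc k))) * indicator (shallow ((1/2) ^ k)) x)"
    (is "_ \<le> 1 + (\<Sum>k. ?f k)")
proof -
  define d where "d = halfspace_depth n \<mu> x"
  have d0: "d \<ge> 0" unfolding d_def by (rule depth_nonneg[OF n x])
  have sh: "x \<in> shallow ((1/2) ^ k)" if "d < (1/2) ^ k" for k
    using depth_less_imp_shallow[OF n x] that by (simp add: d_def)
  consider "d \<ge> 1" | "d = 0" | "0 < d" "d < 1" using d0 by linarith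
  thus ?thesis
  proof cases
    case 1
    hence "d powr p \<ge> 1" using p by (intro ge_one_powr_ge_zero) auto
    hence le: "1 / d powr p \<le> 1" by (subst divide_le_eq_1_pos) auto
    have "1 / ennreal (d powr p) = ennreal (1 / d powr p)"
      using 1 divide_ennreal[of 1 "d powr p"] by simp
    also have "\<dots> \<le> 1" using ennreal_leI[OF le] by simp
    finally have "1 / ennreal (d powr p) \<le> 1" .
    also have "1 \<le> 1 + (\<Sum>k. ?f k)" by simp
    finally show ?thesis by (simp add: d_def)
  next
    case 2
    have ge: "1 \<le> ?f k" for k
    proof -
      have "x \<in> shallow ((1/2) ^ k)" using 2 by (intro sh) simp
      moreover have "(1::real) \<le> 2 powr (p * real (Suc k))" using p by (intro ge_one_powr_ge_zero) auto
      ultimately show ?thesis by simp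
    qed
    have "(\<Sum>k. ?f k) = \<top>"
    proof (rule ccontr)
      assume "(\<Sum>k. ?f k) \<noteq> \<top>"
      moreover define s where "s = (\<Sum>k. ?f k)"
      ultimately have "s \<noteq> \<top>" by simp
      then obtain r where "s = ennreal r" "r \<ge> 0" by (cases s rule: ennreal_cases) auto
      hence r: "(\<Sum>k. ?f k) = ennreal r" "r \<ge> 0" by (simp_all only: s_def)
      obtain N :: nat where N: "r < real N" using reals_Archimedean2 by blast
      have "of_nat N = (\<Sum>k<N. (1::ennreal))" by simp
      also have "\<dots> \<le> (\<Sum>k<N. ?f k)" using ge by (intro sum_mono)
      also have "\<dots> \<le> (\<Sum>k. ?f k)" by (rule sum_le_suminf) auto
      finally have "ennreal (real N) \<le> ennreal r" using r by (simp add: ennreal_of_nat_eq_real_of_nat)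
      thus False using N r(2) by (simp add: ennreal_le_iff)
    qed
    thus ?thesis by simp
  next
    case 3
    have "\<exists>k. (1/2) ^ k \<le> d" using real_arch_pow_inv[of d "1/2"] 3 by (auto intro: less_imp_le)
    \<comment> \<open>\<open>K\<close> is positive because the depth is below 1, and its predecessor
      \<open>k\<close> is the dyadic level of the depth.\<close>
    define K where "K = (LEAST k. (1/2) ^ k \<le> d)"
    have K: "(1/2) ^ K \<le> d" unfolding K_def by (rule LeastI_ex) fact
    have "K \<noteq> 0" using K 3 by (auto intro: ccontr)
    then obtain k where k: "K = Suc k" using not0_implies_Suc by blast
    have "\<not> (1/2) ^ k \<le> d" unfolding K_def
      using k K_def not_less_Least[of k "\<lambda>k. (1/2) ^ k \<le> d"] by simp
    hence x_sh: "x \<in> shallow ((1/2) ^ k)" by (intro sh) simp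
    have "2 powr (- (p * real (Suc k))) = ((1/2) ^ Suc k) powr p"
    proof -
      have "(1/2::real) ^ Suc k = 2 powr (- real (Suc k))"
        by (simp add: powr_minus powr_realpow power_one_over inverse_eq_divide del: power_Suc of_nat_Suc)
      thus ?thesis by (simp add: powr_powr mult.commute del: power_Suc of_nat_Suc)
    qed
    also have "\<dots> \<le> d powr p" using K k p by (intro powr_mono2) auto
    finally have "1 / d powr p \<le> 1 / 2 powr (- (p * real (Suc k)))"
      using 3 by (intro divide_left_mono) auto
    also have "\<dots> = 2 powr (p * real (Suc k))" by (simp add: powr_minus divide_inverse)
    finally have le: "1 / d powr p \<le> 2 powr (p * real (Suc k))" .
    have "1 / ennreal (d powr p) = ennreal (1 / d powr p)"
      using 3 divide_ennreal[of 1 "d powr p"] by simp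
    also have "\<dots> \<le> ennreal (2 powr (p * real (Suc k)))" using le by (rule ennreal_leI)
    also have "\<dots> = ?f k" using x_sh by simp
    also have "\<dots> \<le> sum ?f {k}" by (rule member_le_sum[of k "{k}" ?f]) auto
    also have "\<dots> \<le> (\<Sum>k. ?f k)" by (rule sum_le_suminf) auto
    also have "\<dots> \<le> 1 + (\<Sum>k. ?f k)" by (rule add_increasing) auto
    finally show ?thesis unfolding d_def .
  qed
qed

text \<open>The \<open>k\<close>-th term of the majorant has integral at most a constant times
  \<open>2 powr (p * k)\<close> times \<open>2 powr (- q * k)\<close>, with \<open>q\<close> the
  decay exponent of the shallow region. As \<open>p < q\<close>, the series is dominated by a
  geometric one.\<close>

lemma depth_integral_finite:
  assumes n: "n \<ge> 1" and p: "0 < p" "p \<le> 1 / (8 * real n)"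
  shows "depth_integral n \<mu> p < \<infinity>"
proof -
  obtain C where C: "C > 0" "\<And>t. t > 0 \<Longrightarrow> prob (shallow t) \<le> C * t powr (1 / (4 * real n))"
    by (rule prob_shallow_bound[OF n]) blast
  define q where "q = 1 / (4 * real n)"
  have "1 / (8 * real n) < 1 / (4 * real n)" using n by (simp add: field_simps)
  hence pq: "p < q" using p by (simp add: q_def)
  let ?f = "\<lambda>k x. ennreal (2 powr (p * real (Suc k))) * indicator (shallow ((1/2) ^ k)) x"
  define g where "g = (\<lambda>k::nat. C * 2 powr p * (2 powr (p - q)) ^ k)"
  have "(2::real) powr (p - q) < 1" using pq by (simp add: powr_less_one)
  hence g: "summable g" unfolding g_def by (intro summable_mult summable_geometric) simp
  have g0: "g k \<ge> 0" for k using C by (simp add: g_def)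
  have bound: "(\<integral>\<^sup>+ x. ?f k x \<partial>\<mu>) \<le> ennreal (g k)" for k
  proof -
    have "(\<integral>\<^sup>+ x. ?f k x \<partial>\<mu>) = ennreal (2 powr (p * real (Suc k))) * emeasure \<mu> (shallow ((1/2) ^ k))"
      using shallow_sets by (simp add: nn_integral_cmult_indicator)
    also have "\<dots> = ennreal (2 powr (p * real (Suc k)) * prob (shallow ((1/2) ^ k)))"
      by (simp add: emeasure_eq_measure ennreal_mult'')
    also have "2 powr (p * real (Suc k)) * prob (shallow ((1/2) ^ k)) \<le> 2 powr (p * real (Suc k)) * (C * ((1/2) ^ k) powr q)"
      using C(2)[of "(1/2) ^ k"] by (intro mult_left_mono) (auto simp: q_def)
    also have "((1/2) ^ k) powr q = 2 powr (- (q * real k))"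
    proof -
      have "(1/2::real) ^ k = 2 powr (- real k)"
        by (simp add: powr_minus powr_realpow power_one_over inverse_eq_divide)
      thus ?thesis by (simp add: powr_powr mult.commute)
    qed
    also have "2 powr (p * real (Suc k)) * (C * 2 powr (- (q * real k))) = C * (2 powr (p * real (Suc k)) * 2 powr (- (q * real k)))"
      by simp
    also have "\<dots> = C * 2 powr (p + (p - q) * real k)"
      unfolding powr_add[symmetric] by (simp add: algebra_simps)
    also have "\<dots> = g k" by (simp add: g_def powr_add powr_powr flip: powr_realpow)
    finally show ?thesis by (simp add: ennreal_leI)
  qed
  have "depth_integral n \<mu> p \<le> (\<integral>\<^sup>+ x. 1 + (\<Sum>k. ?f k x) \<partial>\<mu>)"
    unfolding depth_integral_def
    by (intro nn_integral_mono depth_powr_le_sum[OF n _ p(1)]) (simp add: space_mu)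
  also have "\<dots> = 1 + (\<Sum>k. \<integral>\<^sup>+ x. ?f k x \<partial>\<mu>)"
    using shallow_sets by (simp add: nn_integral_add nn_integral_suminf emeasure_space_1)
  also have "\<dots> \<le> 1 + (\<Sum>k. ennreal (g k))"
    by (intro add_left_mono suminf_le bound) auto
  also have "\<dots> = 1 + ennreal (\<Sum>k. g k)" using suminf_ennreal2[OF g0 g] by simp
  also have "\<dots> < \<infinity>" by simp
  finally show ?thesis .
qed

end

theorem theorem1p4:
  shows "\<exists>c::real. c > 0 \<and>
    (\<forall>(n::nat) (\<mu> :: (nat \<Rightarrow> real) measure) (p::real).
       n \<ge> 1 \<longrightarrow> log_concave_prob n \<mu> \<longrightarrow> 0 < p \<longrightarrow> p \<le> c / real n \<longrightarrow>
       depth_integral n \<mu> p < \<infinity>)"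
\<comment> \<open>The choice 1/8 keeps \<open>p\<close> strictly below the decay exponent
  \<open>1 / (4 * n)\<close>.\<close>
proof (intro exI[of _ "1/8"] conjI allI impI)
  fix n :: nat and \<mu> :: "(nat \<Rightarrow> real) measure" and p :: real
  assume n: "n \<ge> 1" and lc: "log_concave_prob n \<mu>" and p: "0 < p" "p \<le> 1/8 / real n"
  interpret log_concave n \<mu> by unfold_locales (fact lc)
  show "depth_integral n \<mu> p < \<infinity>" using n p by (intro depth_integral_finite) auto
qed simp

end
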